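(* Let $M$ be an $\mathcal{R}_1$-injective special inverse monoid defined by a special inverse monoid presentation with generating set $X$, and let $w$ be a word over $X^{\pm1}$. Then: (1) $S\Gamma(w)$ has finitely many blocks; (2) every preblock of $S\Gamma(w)$ lies in a block; (3) every vertex of $S\Gamma(w)$ lies in at least one block; (4) all but finitely many edges of $S\Gamma(w)$ lie in at least one block; (5) any edge of $S\Gamma(w)$ which does not lie in a block is a cut edge, and is traversed (in one direction or the other) by the path starting at the root of $S\Gamma(w)$ and labelled $w$; (6) every block has a root which is the vertex corresponding to some prefix of $w$, i.e. the end vertex of the path starting at the root of $S\Gamma(w)$ and labelled by some (possibly empty) prefix of $w$.
   Context: An inverse monoid presentation $\langle X \mid R\rangle$ ($X$, $R$ possibly infinite) defines the quotient of the free inverse monoid on $X$ by the congruence generated by $R$; it is special if every relation has the form $r=1$ with $r$ a word over $X^{\pm1}=X\cup\{x^{-1}:x\in X\}$, and an inverse monoid is special if it admits such a presentation. $\mathcal{R}_1=\{m\in M: mm^{-1}=1\}$ is the $\mathcal{R}$-class of $1$. $M$ is $\mathcal{R}_1$-injective if the natural morphism from $M$ to its maximal group image $M/\sigma$ ($\sigma$ the least group congruence) is injective on $\mathcal{R}_1$. For $m\in M$ the (right) Schützenberger graph $S\Gamma(m)$ is the $X$-labelled directed graph whose vertex set is the $\mathcal{R}$-class of $m$, with an edge labelled $x\in X$ from $s$ to $sx$ whenever both $s$ and $sx$ lie in this $\mathcal{R}$-class; its root is $mm^{-1}$. For a word $w$, $S\Gamma(w)$ is the Schützenberger graph of the element represented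 by $w$. Words over $X^{\pm1}$ label paths, with $x^{-1}$ meaning that an $x$-edge is traversed backwards. $S\Gamma(w)$ is bi-deterministic: no two distinct edges with the same label share a start vertex or an end vertex. A preblock of an $X$-labelled directed graph $\Gamma$ is a subgraph (a set of vertices and a set of edges between them, not necessarily an induced subgraph) which is the image of an injective morphism of labelled directed graphs from $S\Gamma(1)$ to $\Gamma$. A root of a preblock is a vertex which is the image of the vertex $1\in S\Gamma(1)$ under such a morphism. A block of $\Gamma$ is a preblock which is maximal under inclusion (of vertices and edges) among preblocks. A cut edge of a connected graph is an edge whose removal disconnects the underlying undirected graph. *)

theory Defs
  imports
    "HOL-Algebra.Group"
    "HOL-Library.Sublist"
    "Graph_Theory.Digraph_Component"
begin

section \<open>Congruences on monoids\<close>

definition congruence_on :: "('m, 'b) monoid_scheme \<Rightarrow> 'm rel \<Rightarrow> bool" where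
  "congruence_on M \<rho> \<longleftrightarrow> equiv (carrier M) \<rho> \<and>
     (\<forall>a b c d. (a, b) \<in> \<rho> \<longrightarrow> (c, d) \<in> \<rho> \<longrightarrow> (a \<otimes>\<^bsub>M\<^esub> c, b \<otimes>\<^bsub>M\<^esub> d) \<in> \<rho>)"

definition generated_congruence :: "('m, 'b) monoid_scheme \<Rightarrow> 'm rel \<Rightarrow> 'm rel" where
  "generated_congruence M S = \<Inter>{\<rho>. congruence_on M \<rho> \<and> S \<subseteq> \<rho>}"

definition quotient_monoid :: "('m, 'b) monoid_scheme \<Rightarrow> 'm rel \<Rightarrow> 'm set monoid" where
  "quotient_monoid M \<rho> =
     \<lparr>carrier = carrier M // \<rho>,
      monoid.mult = (\<lambda>A B. \<Union>a\<in>A. \<Union>b\<in>B. \<rho> `` {a \<otimes>\<^bsub>M\<^esub> b}),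
      monoid.one = \<rho> `` {\<one>\<^bsub>M\<^esub>}\<rparr>"

definition group_congruence :: "('m, 'b) monoid_scheme \<Rightarrow> 'm rel \<Rightarrow> bool" where
  "group_congruence M \<rho> \<longleftrightarrow> congruence_on M \<rho> \<and> group (quotient_monoid M \<rho>)"

text \<open>The order on relations is inclusion; on an inverse monoid the least group
  congruence exists.\<close>

definition least_group_congruence :: "('m, 'b) monoid_scheme \<Rightarrow> 'm rel" where
  "least_group_congruence M = (LEAST \<rho>. group_congruence M \<rho>)"


section \<open>Inverses and the relation R in an inverse monoid\<close>

text \<open>The inverse in the sense of inverse semigroups (to be distinguished from
  the group inverse \<^const>\<open>m_inv\<close>); in an inverse monoid it exists and is unique.\<close>

definition sinv :: "('m, 'b) monoid_scheme \<Rightarrow> 'm \<Rightarrow> 'm" where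
  "sinv M a = (THE b. b \<in> carrier M \<and> a \<otimes>\<^bsub>M\<^esub> b \<otimes>\<^bsub>M\<^esub> a = a \<and> b \<otimes>\<^bsub>M\<^esub> a \<otimes>\<^bsub>M\<^esub> b = b)"

text \<open>Green's relation: two elements are R-related if they generate the same
  principal right ideal.\<close>

definition R_class :: "('m, 'b) monoid_scheme \<Rightarrow> 'm \<Rightarrow> 'm set" where
  "R_class M m = {s \<in> carrier M.
     (\<lambda>c. s \<otimes>\<^bsub>M\<^esub> c) ` carrier M = (\<lambda>c. m \<otimes>\<^bsub>M\<^esub> c) ` carrier M}"

definition R_one :: "('m, 'b) monoid_scheme \<Rightarrow> 'm set" where
  "R_one M = {m \<in> carrier M. m \<otimes>\<^bsub>M\<^esub> sinv M m = \<one>\<^bsub>M\<^esub>}"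

definition R1_injective :: "('m, 'b) monoid_scheme \<Rightarrow> bool" where
  "R1_injective M \<longleftrightarrow> inj_on (\<lambda>m. least_group_congruence M `` {m}) (R_one M)"


section \<open>Inverse monoid presentations\<close>

datatype 'x letter = Pos 'x | Neg 'x

primrec inv_letter :: "'x letter \<Rightarrow> 'x letter" where
  "inv_letter (Pos x) = Neg x"
| "inv_letter (Neg x) = Pos x"

definition inv_word :: "'x letter list \<Rightarrow> 'x letter list" where
  "inv_word w = rev (map inv_letter w)"

definition words :: "'x set \<Rightarrow> 'x letter list set" where
  "words X = lists (Pos ` X \<union> Neg ` X)"

definition word_monoid :: "'x set \<Rightarrow> 'x letter list monoid" where
  "word_monoid X = \<lparr>carrier = words X, monoid.mult = (@), monoid.one = []\<rparr>"

text \<open>The free inverse monoid is the quotient of the monoid of words by the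
  Vagner congruence.\<close>

definition vagner_relations :: "'x set \<Rightarrow> 'x letter list rel" where
  "vagner_relations X =
     {(u @ inv_word u @ u, u) | u. u \<in> words X} \<union>
     {(u @ inv_word u @ v @ inv_word v, v @ inv_word v @ u @ inv_word u) | u v.
        u \<in> words X \<and> v \<in> words X}"

definition vagner_congruence :: "'x set \<Rightarrow> 'x letter list rel" where
  "vagner_congruence X = generated_congruence (word_monoid X) (vagner_relations X)"

definition free_inverse_monoid :: "'x set \<Rightarrow> 'x letter list set monoid" where
  "free_inverse_monoid X = quotient_monoid (word_monoid X) (vagner_congruence X)"

definition fim_val :: "'x set \<Rightarrow> 'x letter list \<Rightarrow> 'x letter list set" where
  "fim_val X u = vagner_congruence X `` {u}"

text \<open>A set of relations \<open>R\<close> consists of pairs of words, the pair \<open>(u, v)\<close> standing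
  for the relation \<open>u = v\<close>.\<close>

definition presentation_congruence ::
  "'x set \<Rightarrow> 'x letter list rel \<Rightarrow> 'x letter list set rel" where
  "presentation_congruence X R =
     generated_congruence (free_inverse_monoid X) ((\<lambda>(u, v). (fim_val X u, fim_val X v)) ` R)"

definition presented_monoid ::
  "'x set \<Rightarrow> 'x letter list rel \<Rightarrow> 'x letter list set set monoid" where
  "presented_monoid X R =
     quotient_monoid (free_inverse_monoid X) (presentation_congruence X R)"

definition val ::
  "'x set \<Rightarrow> 'x letter list rel \<Rightarrow> 'x letter list \<Rightarrow> 'x letter list set set" where
  "val X R u = presentation_congruence X R `` {fim_val X u}"

definition special_presentation :: "'x set \<Rightarrow> 'x letter list rel \<Rightarrow> bool" where
  "special_presentation X R \<longleftrightarrow> R \<subseteq> words X \<times> words X \<and> (\<forall>(u, v) \<in> R. v = [])"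


section \<open>Labelled directed graphs\<close>

text \<open>An edge from \<open>u\<close> to \<open>v\<close> labelled \<open>x\<close> is the triple \<open>(u, x, v)\<close>, so there is at
  most one edge with given ends and label; this is no restriction for Schuetzenberger
  graphs and their subgraphs. Every morphism is then determined by its action on
  vertices, and it is injective as soon as it is injective on vertices.\<close>

type_synonym ('v, 'x) edge = "'v \<times> 'x \<times> 'v"
type_synonym ('v, 'x) lgraph = "('v, ('v, 'x) edge) pre_digraph"

definition lgraph :: "'v set \<Rightarrow> ('v, 'x) edge set \<Rightarrow> ('v, 'x) lgraph" where
  "lgraph V E = \<lparr>verts = V, arcs = E, tail = (\<lambda>(u, x, v). u), head = (\<lambda>(u, x, v). v)\<rparr>"

definition map_edge :: "('u \<Rightarrow> 'v) \<Rightarrow> ('u, 'x) edge \<Rightarrow> ('v, 'x) edge" where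
  "map_edge f = (\<lambda>(u, x, v). (f u, x, f v))"

definition injective_morphism ::
  "('u, 'x) lgraph \<Rightarrow> ('v, 'x) lgraph \<Rightarrow> ('u \<Rightarrow> 'v) \<Rightarrow> bool" where
  "injective_morphism S G f \<longleftrightarrow>
     f ` verts S \<subseteq> verts G \<and> map_edge f ` arcs S \<subseteq> arcs G \<and> inj_on f (verts S)"

definition image_graph :: "('u \<Rightarrow> 'v) \<Rightarrow> ('u, 'x) lgraph \<Rightarrow> ('v, 'x) lgraph" where
  "image_graph f S = lgraph (f ` verts S) (map_edge f ` arcs S)"

definition cut_edge :: "('v, 'e) pre_digraph \<Rightarrow> 'e \<Rightarrow> bool" where
  "cut_edge G e \<longleftrightarrow> Digraph_Component.connected G \<and> e \<in> arcs G \<and>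
     \<not> Digraph_Component.connected (pre_digraph.del_arc G e)"

text \<open>\<open>labelled_path G u w p v\<close>: the path starting at \<open>u\<close> and labelled by the word \<open>w\<close>
  traverses successively the edges in the list \<open>p\<close>, in one direction or the other, and
  ends at \<open>v\<close>.\<close>

inductive labelled_path ::
  "('v, 'x) lgraph \<Rightarrow> 'v \<Rightarrow> 'x letter list \<Rightarrow> ('v, 'x) edge list \<Rightarrow> 'v \<Rightarrow> bool"
  for G :: "('v, 'x) lgraph" where
  empty: "v \<in> verts G \<Longrightarrow> labelled_path G v [] [] v"
| forward: "(u, x, u') \<in> arcs G \<Longrightarrow> labelled_path G u' w p v \<Longrightarrow>
    labelled_path G u (Pos x # w) ((u, x, u') # p) v"
| backward: "(u', x, u) \<in> arcs G \<Longrightarrow> labelled_path G u' w p v \<Longrightarrow>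
    labelled_path G u (Neg x # w) ((u', x, u) # p) v"


section \<open>Schuetzenberger graphs, preblocks and blocks\<close>

type_synonym 'x pres_elem = "'x letter list set set"

definition schutz_graph ::
  "'x set \<Rightarrow> 'x letter list rel \<Rightarrow> 'x pres_elem \<Rightarrow> ('x pres_elem, 'x) lgraph" where
  "schutz_graph X R m =
     (let M = presented_monoid X R; C = R_class M m in
      lgraph C {(s, x, s \<otimes>\<^bsub>M\<^esub> val X R [Pos x]) | s x.
        s \<in> C \<and> x \<in> X \<and> s \<otimes>\<^bsub>M\<^esub> val X R [Pos x] \<in> C})"

definition schutz_root :: "'x set \<Rightarrow> 'x letter list rel \<Rightarrow> 'x pres_elem \<Rightarrow> 'x pres_elem" where
  "schutz_root X R m = m \<otimes>\<^bsub>presented_monoid X R\<^esub> sinv (presented_monoid X R) m"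

abbreviation schutz_graph_one ::
  "'x set \<Rightarrow> 'x letter list rel \<Rightarrow> ('x pres_elem, 'x) lgraph" where
  "schutz_graph_one X R \<equiv> schutz_graph X R \<one>\<^bsub>presented_monoid X R\<^esub>"

definition preblock ::
  "'x set \<Rightarrow> 'x letter list rel \<Rightarrow> ('v, 'x) lgraph \<Rightarrow> ('v, 'x) lgraph \<Rightarrow> bool" where
  "preblock X R G B \<longleftrightarrow>
     (\<exists>f. injective_morphism (schutz_graph_one X R) G f \<and>
          B = image_graph f (schutz_graph_one X R))"

definition preblock_root ::
  "'x set \<Rightarrow> 'x letter list rel \<Rightarrow> ('v, 'x) lgraph \<Rightarrow> ('v, 'x) lgraph \<Rightarrow> 'v \<Rightarrow> bool" where
  "preblock_root X R G B r \<longleftrightarrow>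
     (\<exists>f. injective_morphism (schutz_graph_one X R) G f \<and>
          B = image_graph f (schutz_graph_one X R) \<and> r = f \<one>\<^bsub>presented_monoid X R\<^esub>)"

definition block ::
  "'x set \<Rightarrow> 'x letter list rel \<Rightarrow> ('v, 'x) lgraph \<Rightarrow> ('v, 'x) lgraph \<Rightarrow> bool" where
  "block X R G B \<longleftrightarrow> pre_digraph.max_subgraph G (preblock X R G) B"

end

theory Submission
  imports Defs
begin

text \<open>
  Write \<open>\<Gamma>\<close> for the Schuetzenberger graph of the value of \<open>w\<close>. The proof rests on two ideas.

  The first one is algebraic: the preblocks of \<open>\<Gamma>\<close> are the left translates \<open>P s\<close> of the graph
  of \<open>1\<close>, with vertex set \<open>s R\<^sub>1\<close>, where \<open>s\<close> ranges over the vertices of \<open>\<Gamma>\<close>. A morphism from the graph of \<open>1\<close> commutes with the reading of words, so it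
  is left translation by the image of \<open>1\<close> (\<open>morphism_eq_left_translation\<close>). Conversely, left
  translation is injective on \<open>R\<^sub>1\<close> by \<open>R\<^sub>1\<close>-injectivity, because in the maximal group image it can be
  cancelled (\<open>inj_on_left_translation\<close>). As \<open>R\<^sub>1\<close> is a submonoid, \<open>P t\<close> is contained in \<open>P s\<close>
  whenever \<open>t\<close> is a vertex of \<open>P s\<close>.

  The second one is a way to use the presentation without any rewriting
  (\<open>bideterministic_graph.reads_val_cong\<close>). In a bi-deterministic graph the words act on vertices by
  partial injections; if moreover each relator labels a loop at each vertex, then this action factors
  through \<open>M\<close>, so words of equal value can be read between the same pairs of vertices. Applied
  to two graphs built from \<open>\<Gamma>\<close>, it gives the two remaining facts.

  (a) Let \<open>\<Delta>\<close> consist of the path labelled \<open>w\<close> from the root of \<open>\<Gamma>\<close> and of the preblocks \<open>P s\<close> for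
  its vertices \<open>s\<close>. Relators are loops in each preblock, hence in \<open>\<Delta>\<close>, and \<open>w\<close> is readable at the
  root. If a word \<open>h\<close> leads from the root to some vertex of \<open>\<Gamma>\<close>, then
  \<open>w w\<^sup>-\<^sup>1 h h\<^sup>-\<^sup>1\<close> and \<open>w w\<^sup>-\<^sup>1\<close> have the same value, so \<open>h\<close> is readable at the root in \<open>\<Delta>\<close>, too.
  Hence \<open>\<Delta>\<close> is all of \<open>\<Gamma>\<close> (\<open>preblocks_at_prefixes_cover\<close>). So each vertex, and hence each
  preblock, lies in one of the finitely many \<open>P s\<close> with \<open>s\<close> on the path; the blocks are the maximal
  ones among these, and an edge outside all blocks is on the path.

  (b) Let \<open>e\<close> be an edge that lies in no preblock, and suppose that it is not a cut edge. In the double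
  cover of \<open>\<Gamma>\<close> in which exactly \<open>e\<close> changes the sheet, relators still label loops, as their loops
  in \<open>\<Gamma>\<close> stay in preblocks and so avoid \<open>e\<close>. As \<open>e\<close> is not a cut edge, some closed path at the root,
  with label \<open>z\<close>, traverses \<open>e\<close> exactly once. Then \<open>w w\<^sup>-\<^sup>1 z\<close> and \<open>w w\<^sup>-\<^sup>1\<close> have the same value, but in
  the cover the first one changes the sheet and the second one does not
  (\<open>cut_edge_if_not_in_preblock\<close>).
\<close>

section \<open>Inverse monoids and Green's relation R\<close>

locale inverse_monoid = monoid M for M (structure) +
  assumes regular: "a \<in> carrier M \<Longrightarrow> \<exists>b\<in>carrier M. a \<otimes> b \<otimes> a = a \<and> b \<otimes> a \<otimes> b = b"
    and idem_commute: "\<lbrakk>e \<in> carrier M; f \<in> carrier M; e \<otimes> e = e; f \<otimes> f = f\<rbrakk> \<Longrightarrow> e \<otimes> f = f \<otimes> e"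
begin

lemma inverse_unique:
  assumes "a \<in> carrier M" "b \<in> carrier M" "c \<in> carrier M"
    and "a \<otimes> b \<otimes> a = a" "b \<otimes> a \<otimes> b = b" "a \<otimes> c \<otimes> a = a" "c \<otimes> a \<otimes> c = c"
  shows "b = c"
proof -
  have i: "(a \<otimes> b) \<otimes> (a \<otimes> b) = a \<otimes> b" "(a \<otimes> c) \<otimes> (a \<otimes> c) = a \<otimes> c"
    "(b \<otimes> a) \<otimes> (b \<otimes> a) = b \<otimes> a" "(c \<otimes> a) \<otimes> (c \<otimes> a) = c \<otimes> a"
    using assms by (metis m_assoc m_closed)+
  have "b = (b \<otimes> a) \<otimes> b" using assms by simp
  also have "\<dots> = (b \<otimes> (a \<otimes> c \<otimes> a)) \<otimes> b" using assms by simp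
  also have "\<dots> = (b \<otimes> a) \<otimes> (c \<otimes> a) \<otimes> b" using assms(1-3) by (simp add: m_assoc)
  also have "\<dots> = (c \<otimes> a) \<otimes> (b \<otimes> a) \<otimes> b" using idem_commute[of "b \<otimes> a" "c \<otimes> a"] i assms by simp
  also have "\<dots> = c \<otimes> (a \<otimes> (b \<otimes> a \<otimes> b))" using assms(1-3) by (simp add: m_assoc)
  also have "\<dots> = (c \<otimes> a \<otimes> c) \<otimes> (a \<otimes> b)" using assms by (simp add: m_assoc)
  also have "\<dots> = c \<otimes> ((a \<otimes> c) \<otimes> (a \<otimes> b))" using assms(1-3) by (simp add: m_assoc)
  also have "\<dots> = c \<otimes> ((a \<otimes> b) \<otimes> (a \<otimes> c))" using idem_commute[of "a \<otimes> b" "a \<otimes> c"] i assms by simp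
  also have "\<dots> = c \<otimes> ((a \<otimes> b \<otimes> a) \<otimes> c)" using assms(1-3) by (simp add: m_assoc)
  also have "\<dots> = c \<otimes> a \<otimes> c" using assms by (simp add: m_assoc)
  finally show ?thesis using assms by simp
qed

lemma sinv_eqI:
  assumes "a \<in> carrier M" "b \<in> carrier M" "a \<otimes> b \<otimes> a = a" "b \<otimes> a \<otimes> b = b"
  shows "sinv M a = b"
  unfolding sinv_def by (rule the_equality) (use assms inverse_unique in blast)+

lemma
  assumes "a \<in> carrier M"
  shows sinv_closed [simp]: "sinv M a \<in> carrier M"
    and mult_sinv_mult: "a \<otimes> sinv M a \<otimes> a = a"
    and sinv_mult_sinv: "sinv M a \<otimes> a \<otimes> sinv M a = sinv M a"
  using regular[OF assms] sinv_eqI[OF assms] by auto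

lemma
  assumes "a \<in> carrier M"
  shows idem_mult_sinv: "(a \<otimes> sinv M a) \<otimes> (a \<otimes> sinv M a) = a \<otimes> sinv M a"
    and idem_sinv_mult: "(sinv M a \<otimes> a) \<otimes> (sinv M a \<otimes> a) = sinv M a \<otimes> a"
  using assms by (metis m_assoc m_closed sinv_closed mult_sinv_mult)+

lemma sinv_idem: "e \<in> carrier M \<Longrightarrow> e \<otimes> e = e \<Longrightarrow> sinv M e = e"
  by (rule sinv_eqI) simp_all

lemma sinv_one [simp]: "sinv M \<one> = \<one>"
  by (rule sinv_idem) simp_all

lemma sinv_mult:
  assumes "a \<in> carrier M" "b \<in> carrier M"
  shows "sinv M (a \<otimes> b) = sinv M b \<otimes> sinv M a"
proof (rule sinv_eqI)
  let ?e = "b \<otimes> sinv M b" and ?f = "sinv M a \<otimes> a"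
  have comm: "?e \<otimes> ?f = ?f \<otimes> ?e"
    using assms by (intro idem_commute) (simp_all add: idem_mult_sinv idem_sinv_mult)
  have "a \<otimes> b \<otimes> (sinv M b \<otimes> sinv M a) \<otimes> (a \<otimes> b) = a \<otimes> (?e \<otimes> ?f) \<otimes> b"
    using assms by (simp add: m_assoc)
  also have "\<dots> = (a \<otimes> sinv M a \<otimes> a) \<otimes> (b \<otimes> sinv M b \<otimes> b)"
    unfolding comm using assms by (simp add: m_assoc)
  finally show "a \<otimes> b \<otimes> (sinv M b \<otimes> sinv M a) \<otimes> (a \<otimes> b) = a \<otimes> b"
    using assms by (simp add: mult_sinv_mult)
  have "sinv M b \<otimes> sinv M a \<otimes> (a \<otimes> b) \<otimes> (sinv M b \<otimes> sinv M a)
      = sinv M b \<otimes> (?f \<otimes> ?e) \<otimes> sinv M a"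
    using assms by (simp add: m_assoc)
  also have "\<dots> = (sinv M b \<otimes> b \<otimes> sinv M b) \<otimes> (sinv M a \<otimes> a \<otimes> sinv M a)"
    unfolding comm[symmetric] using assms by (simp add: m_assoc)
  finally show "sinv M b \<otimes> sinv M a \<otimes> (a \<otimes> b) \<otimes> (sinv M b \<otimes> sinv M a) = sinv M b \<otimes> sinv M a"
    using assms by (simp add: sinv_mult_sinv)
qed (use assms in simp_all)

lemma R_class_iff:
  assumes "m \<in> carrier M"
  shows "s \<in> R_class M m \<longleftrightarrow> s \<in> carrier M \<and> s \<otimes> sinv M s = m \<otimes> sinv M m"
proof (intro iffI conjI)
  assume s: "s \<in> R_class M m"
  then show sc: "s \<in> carrier M" by (simp add: R_class_def)
  have abs: "(t \<otimes> sinv M t) \<otimes> (t' \<otimes> sinv M t') = t' \<otimes> sinv M t'"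
    if tt: "t \<in> carrier M" "t' \<in> carrier M" "(\<lambda>c. t \<otimes> c) ` carrier M = (\<lambda>c. t' \<otimes> c) ` carrier M"
    for t t'
  proof -
    have "t' \<in> (\<lambda>c. t' \<otimes> c) ` carrier M"
      using tt(2) by (intro image_eqI[where x=\<one>]) simp_all
    with tt(3) obtain c where c: "c \<in> carrier M" "t' = t \<otimes> c" by auto
    have "t \<otimes> sinv M t \<otimes> t' = (t \<otimes> sinv M t \<otimes> t) \<otimes> c"
      using tt c by (simp add: m_assoc)
    then have "t \<otimes> sinv M t \<otimes> t' = t'"
      using tt c by (simp add: mult_sinv_mult)
    then show ?thesis
      using tt by (metis m_assoc m_closed sinv_closed)
  qed
  have eq: "(\<lambda>c. s \<otimes> c) ` carrier M = (\<lambda>c. m \<otimes> c) ` carrier M"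
    using s by (simp add: R_class_def)
  have "(s \<otimes> sinv M s) \<otimes> (m \<otimes> sinv M m) = (m \<otimes> sinv M m) \<otimes> (s \<otimes> sinv M s)"
    using assms sc by (intro idem_commute) (simp_all add: idem_mult_sinv)
  then show "s \<otimes> sinv M s = m \<otimes> sinv M m"
    using abs[OF sc assms eq] abs[OF assms sc eq[symmetric]] by simp
next
  assume s: "s \<in> carrier M \<and> s \<otimes> sinv M s = m \<otimes> sinv M m"
  have sub: "(\<lambda>c. t \<otimes> c) ` carrier M \<subseteq> (\<lambda>c. t' \<otimes> c) ` carrier M"
    if tt: "t \<in> carrier M" "t' \<in> carrier M" "t \<otimes> sinv M t = t' \<otimes> sinv M t'" for t t'
  proof (rule image_subsetI)
    fix c assume c: "c \<in> carrier M"
    have "t \<otimes> c = (t \<otimes> sinv M t) \<otimes> (t \<otimes> c)"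
      using tt c by (metis m_assoc m_closed mult_sinv_mult sinv_closed)
    also have "\<dots> = t' \<otimes> (sinv M t' \<otimes> (t \<otimes> c))"
      using tt c by (simp add: m_assoc)
    finally show "t \<otimes> c \<in> (\<lambda>c. t' \<otimes> c) ` carrier M"
      using tt c by (intro image_eqI[where x="sinv M t' \<otimes> (t \<otimes> c)"]) auto
  qed
  show "s \<in> R_class M m"
    using sub[of s m] sub[of m s] s assms by (auto simp: R_class_def)
qed

lemma mem_R_class_self [simp]: "m \<in> carrier M \<Longrightarrow> m \<in> R_class M m"
  by (simp add: R_class_iff)

lemma R_class_closed: "s \<in> R_class M m \<Longrightarrow> s \<in> carrier M"
  by (simp add: R_class_def)

text \<open>Inside an R-class, right multiplication by \<open>x\<close> is undone by right multiplication by
  the inverse of \<open>x\<close>. This is what makes Schuetzenberger graphs bi-deterministic.\<close>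

lemma R_class_mult_iff:
  assumes m: "m \<in> carrier M" and s: "s \<in> R_class M m" and x: "x \<in> carrier M"
  shows "s \<otimes> x \<in> R_class M m \<longleftrightarrow> s \<otimes> x \<otimes> sinv M x = s"
proof -
  have sc: "s \<in> carrier M" using s by (rule R_class_closed)
  have R: "s \<otimes> x \<in> R_class M m \<longleftrightarrow> s \<otimes> x \<otimes> sinv M x \<otimes> sinv M s = s \<otimes> sinv M s"
    using s x sc by (simp add: R_class_iff[OF m] sinv_mult m_assoc)
  have "(s \<otimes> x \<otimes> sinv M x \<otimes> sinv M s) \<otimes> s = s \<otimes> x \<otimes> sinv M x"
  proof -
    have "(s \<otimes> x \<otimes> sinv M x \<otimes> sinv M s) \<otimes> s = s \<otimes> ((x \<otimes> sinv M x) \<otimes> (sinv M s \<otimes> s))"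
      using sc x by (simp add: m_assoc)
    also have "\<dots> = s \<otimes> ((sinv M s \<otimes> s) \<otimes> (x \<otimes> sinv M x))"
      using sc x idem_commute[of "x \<otimes> sinv M x" "sinv M s \<otimes> s"]
      by (simp add: idem_mult_sinv idem_sinv_mult)
    also have "\<dots> = (s \<otimes> sinv M s \<otimes> s) \<otimes> (x \<otimes> sinv M x)"
      using sc x by (simp add: m_assoc)
    also have "\<dots> = s \<otimes> (x \<otimes> sinv M x)"
      using sc by (simp add: mult_sinv_mult)
    finally show ?thesis using sc x by (simp add: m_assoc)
  qed
  then show ?thesis
    unfolding R using sc mult_sinv_mult by metis
qed

lemma R_class_prefix:
  assumes m: "m \<in> carrier M" and s: "s \<in> R_class M m"
    and x: "x \<in> carrier M" and y: "y \<in> carrier M" and sxy: "s \<otimes> x \<otimes> y \<in> R_class M m"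
  shows "s \<otimes> x \<in> R_class M m"
proof -
  have sc: "s \<in> carrier M" using s by (rule R_class_closed)
  have "s \<otimes> (x \<otimes> y) \<otimes> sinv M (x \<otimes> y) = s"
    using R_class_mult_iff[OF m s, of "x \<otimes> y"] sxy sc x y by (simp add: m_assoc)
  then have *: "s \<otimes> x \<otimes> y \<otimes> sinv M y \<otimes> sinv M x = s"
    using sc x y by (simp add: sinv_mult m_assoc)
  have "s \<otimes> x \<otimes> sinv M x = s \<otimes> x \<otimes> y \<otimes> sinv M y \<otimes> (sinv M x \<otimes> x \<otimes> sinv M x)"
    using * sc x y by (metis m_assoc m_closed sinv_closed)
  also have "\<dots> = s"
    using * x by (simp add: sinv_mult_sinv)
  finally show ?thesis using R_class_mult_iff[OF m s x] by simp
qed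

lemma R_one_eq: "R_one M = R_class M \<one>"
  by (auto simp: R_one_def R_class_iff)

lemma R_class_mult_right_unit:
  assumes "m \<in> carrier M" "s \<in> R_class M m" "n \<in> R_class M \<one>"
  shows "s \<otimes> n \<in> R_class M m"
proof -
  have "s \<in> carrier M" "n \<in> carrier M" "n \<otimes> sinv M n = \<one>"
    using assms by (auto simp: R_class_iff)
  then show ?thesis
    using R_class_mult_iff[OF assms(1,2)] by (simp add: m_assoc)
qed

end

text \<open>For a presented monoid only the idempotents of the form \<open>u u\<^sup>-\<^sup>1\<close>, with \<open>u\<close> a word, are known to
  commute at first. That suffices: if \<open>f\<close> is idempotent and \<open>g\<close> is an inverse of it, then \<open>f g\<close> and
  \<open>g f\<close> commute, so \<open>g = g f f g = f g g f\<close> is idempotent as well, and \<open>f = f g g f\<close> is a product of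
  two members of \<open>E\<close>.\<close>

lemma (in monoid) inverse_monoid_if_commuting_idempotents:
  assumes inv: "\<And>a. a \<in> carrier G \<Longrightarrow>
      \<exists>b\<in>carrier G. a \<otimes> b \<otimes> a = a \<and> b \<otimes> a \<otimes> b = b \<and> a \<otimes> b \<in> E \<and> b \<otimes> a \<in> E"
    and comm: "\<And>e f. e \<in> E \<Longrightarrow> f \<in> E \<Longrightarrow> e \<otimes> f = f \<otimes> e"
    and E: "E \<subseteq> carrier G"
  shows "inverse_monoid G"
proof unfold_locales
  show "\<exists>b\<in>carrier G. a \<otimes> b \<otimes> a = a \<and> b \<otimes> a \<otimes> b = b" if "a \<in> carrier G" for a
    using inv[OF that] by blast
  have split: "\<exists>e1\<in>E. \<exists>e2\<in>E. f = e1 \<otimes> e2" if f: "f \<in> carrier G" "f \<otimes> f = f" for f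
  proof -
    obtain g where g: "g \<in> carrier G" "f \<otimes> g \<otimes> f = f" "g \<otimes> f \<otimes> g = g" "f \<otimes> g \<in> E" "g \<otimes> f \<in> E"
      using inv[OF f(1)] by blast
    have "(g \<otimes> f) \<otimes> (f \<otimes> g) = g \<otimes> (f \<otimes> f) \<otimes> g"
      using f(1) g(1) by (simp add: m_assoc)
    also have "\<dots> = g"
      using f(2) g(3) by simp
    finally have 1: "(g \<otimes> f) \<otimes> (f \<otimes> g) = g" .
    then have 2: "(f \<otimes> g) \<otimes> (g \<otimes> f) = g" using comm[OF g(4,5)] by simp
    have fg: "(f \<otimes> g) \<otimes> (f \<otimes> g) = f \<otimes> g"
      using f(1) g(1,2) by (simp flip: m_assoc)
    have gf: "(g \<otimes> f) \<otimes> (g \<otimes> f) = g \<otimes> f"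
      using f(1) g(1,3) by (simp flip: m_assoc)
    have "g \<otimes> g = ((f \<otimes> g) \<otimes> (g \<otimes> f)) \<otimes> ((g \<otimes> f) \<otimes> (f \<otimes> g))"
      unfolding 1 2 ..
    also have "\<dots> = (f \<otimes> g) \<otimes> (((g \<otimes> f) \<otimes> (g \<otimes> f)) \<otimes> (f \<otimes> g))"
      using f(1) g(1) by (simp add: m_assoc)
    also have "\<dots> = (f \<otimes> g) \<otimes> ((f \<otimes> g) \<otimes> (g \<otimes> f))"
      unfolding gf 1 2 ..
    also have "\<dots> = ((f \<otimes> g) \<otimes> (f \<otimes> g)) \<otimes> (g \<otimes> f)"
      using f(1) g(1) by (simp add: m_assoc)
    also have "\<dots> = g"
      unfolding fg 2 ..
    finally have "g \<otimes> g = g" .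
    have "f = f \<otimes> (g \<otimes> g) \<otimes> f"
      unfolding \<open>g \<otimes> g = g\<close> using g(2) by simp
    also have "\<dots> = (f \<otimes> g) \<otimes> (g \<otimes> f)"
      using f(1) g(1) by (simp add: m_assoc)
    finally show ?thesis using g by blast
  qed
  show "e \<otimes> f = f \<otimes> e"
    if ef: "e \<in> carrier G" "f \<in> carrier G" "e \<otimes> e = e" "f \<otimes> f = f" for e f
  proof -
    obtain e1 e2 where e: "e1 \<in> E" "e2 \<in> E" "e = e1 \<otimes> e2" using split ef by blast
    obtain f1 f2 where f: "f1 \<in> E" "f2 \<in> E" "f = f1 \<otimes> f2" using split ef by blast
    have prod: "(a \<otimes> b) \<otimes> g = g \<otimes> (a \<otimes> b)"
      if "a \<otimes> g = g \<otimes> a" "b \<otimes> g = g \<otimes> b" "a \<in> carrier G" "b \<in> carrier G" "g \<in> carrier G" for a b g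
    proof -
      have "(a \<otimes> b) \<otimes> g = a \<otimes> (g \<otimes> b)" using that by (simp add: m_assoc)
      also have "\<dots> = (a \<otimes> g) \<otimes> b" using that(3-5) by (simp add: m_assoc)
      finally show ?thesis using that by (simp add: m_assoc)
    qed
    have "e \<otimes> g = g \<otimes> e" if "g \<in> E" for g
      unfolding e(3) using e that E by (intro prod comm) auto
    then show ?thesis
      unfolding f(3) using f E ef(1) by (intro prod[symmetric]) auto
  qed
qed

section \<open>Congruences and quotients\<close>

lemma congruence_on_mult:
  "congruence_on M \<rho> \<Longrightarrow> (a, b) \<in> \<rho> \<Longrightarrow> (c, d) \<in> \<rho> \<Longrightarrow> (a \<otimes>\<^bsub>M\<^esub> c, b \<otimes>\<^bsub>M\<^esub> d) \<in> \<rho>"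
  by (auto simp: congruence_on_def)

lemma congruence_on_equiv: "congruence_on M \<rho> \<Longrightarrow> equiv (carrier M) \<rho>"
  by (simp add: congruence_on_def)

lemma congruence_on_refl: "congruence_on M \<rho> \<Longrightarrow> a \<in> carrier M \<Longrightarrow> (a, a) \<in> \<rho>"
  by (auto simp: congruence_on_def equiv_def refl_on_def)

lemma congruence_on_sym: "congruence_on M \<rho> \<Longrightarrow> (a, b) \<in> \<rho> \<Longrightarrow> (b, a) \<in> \<rho>"
  by (auto simp: congruence_on_def equiv_def sym_def)

lemma congruence_on_trans: "congruence_on M \<rho> \<Longrightarrow> (a, b) \<in> \<rho> \<Longrightarrow> (b, c) \<in> \<rho> \<Longrightarrow> (a, c) \<in> \<rho>"
  by (auto simp: congruence_on_def equiv_def trans_def)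

lemma congruence_on_carrier:
  "congruence_on M \<rho> \<Longrightarrow> (a, b) \<in> \<rho> \<Longrightarrow> a \<in> carrier M \<and> b \<in> carrier M"
  unfolding congruence_on_def by (metis equiv_class_eq_iff)

lemma congruence_onI:
  assumes "\<rho> \<subseteq> carrier M \<times> carrier M" "\<And>a. a \<in> carrier M \<Longrightarrow> (a, a) \<in> \<rho>"
    and "\<And>a b. (a, b) \<in> \<rho> \<Longrightarrow> (b, a) \<in> \<rho>"
    and "\<And>a b c. (a, b) \<in> \<rho> \<Longrightarrow> (b, c) \<in> \<rho> \<Longrightarrow> (a, c) \<in> \<rho>"
    and "\<And>a b c d. (a, b) \<in> \<rho> \<Longrightarrow> (c, d) \<in> \<rho> \<Longrightarrow> (a \<otimes>\<^bsub>M\<^esub> c, b \<otimes>\<^bsub>M\<^esub> d) \<in> \<rho>"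
  shows "congruence_on M \<rho>"
  unfolding congruence_on_def
  by (intro conjI allI impI equivI refl_onI symI transI) (use assms in blast)+

lemma congruence_class_eq_iff:
  "congruence_on M \<rho> \<Longrightarrow> a \<in> carrier M \<Longrightarrow> b \<in> carrier M \<Longrightarrow> \<rho> `` {a} = \<rho> `` {b} \<longleftrightarrow> (a, b) \<in> \<rho>"
  by (rule eq_equiv_class_iff[OF congruence_on_equiv])

lemma (in monoid) congruence_on_Inter:
  assumes "\<And>\<rho>. \<rho> \<in> A \<Longrightarrow> congruence_on G \<rho>" "A \<noteq> {}"
  shows "congruence_on G (\<Inter>A)"
proof (rule congruence_onI)
  show "\<Inter>A \<subseteq> carrier G \<times> carrier G"
    using assms congruence_on_carrier by fastforce
  show "(a, a) \<in> \<Inter>A" if "a \<in> carrier G" for a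
    using that by (auto intro: congruence_on_refl[OF assms(1)])
  show "(b, a) \<in> \<Inter>A" if "(a, b) \<in> \<Inter>A" for a b
    using that by (auto intro: congruence_on_sym[OF assms(1)])
  show "(a, c) \<in> \<Inter>A" if "(a, b) \<in> \<Inter>A" "(b, c) \<in> \<Inter>A" for a b c
    using that by (auto intro: congruence_on_trans[OF assms(1)])
  show "(a \<otimes> c, b \<otimes> d) \<in> \<Inter>A" if "(a, b) \<in> \<Inter>A" "(c, d) \<in> \<Inter>A" for a b c d
    using that by (auto intro: congruence_on_mult[OF assms(1)])
qed

lemma (in monoid) congruence_on_universal: "congruence_on G (carrier G \<times> carrier G)"
  by (rule congruence_onI) auto

lemma (in monoid) congruence_on_generated:
  assumes "S \<subseteq> carrier G \<times> carrier G"
  shows "congruence_on G (generated_congruence G S)"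
  unfolding generated_congruence_def
  by (rule congruence_on_Inter) (use assms congruence_on_universal in auto)

lemma generated_congruence_least:
  "congruence_on M \<rho> \<Longrightarrow> S \<subseteq> \<rho> \<Longrightarrow> generated_congruence M S \<subseteq> \<rho>"
  by (auto simp: generated_congruence_def)

lemma generated_congruence_base: "S \<subseteq> generated_congruence M S"
  by (auto simp: generated_congruence_def)

lemma carrier_quotient_monoid: "carrier (quotient_monoid M \<rho>) = (\<lambda>a. \<rho> `` {a}) ` carrier M"
  by (auto simp: quotient_monoid_def quotient_def)

lemma one_quotient_monoid: "\<one>\<^bsub>quotient_monoid M \<rho>\<^esub> = \<rho> `` {\<one>\<^bsub>M\<^esub>}"
  by (simp add: quotient_monoid_def)

lemma (in monoid) mult_quotient_monoid:
  assumes c: "congruence_on G \<rho>" and a: "a \<in> carrier G" and b: "b \<in> carrier G"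
  shows "(\<rho> `` {a}) \<otimes>\<^bsub>quotient_monoid G \<rho>\<^esub> (\<rho> `` {b}) = \<rho> `` {a \<otimes> b}"
proof -
  have eq: "\<rho> `` {a' \<otimes> b'} = \<rho> `` {a \<otimes> b}" if "a' \<in> \<rho> `` {a}" "b' \<in> \<rho> `` {b}" for a' b'
    using that congruence_on_mult[OF c, of a a' b b']
    by (intro equiv_class_eq[OF congruence_on_equiv[OF c], symmetric]) simp
  have ne: "\<rho> `` {a} \<noteq> {}" "\<rho> `` {b} \<noteq> {}"
    using congruence_on_refl[OF c] a b by blast+
  have "(\<rho> `` {a}) \<otimes>\<^bsub>quotient_monoid G \<rho>\<^esub> (\<rho> `` {b})
      = (\<Union>a'\<in>\<rho> `` {a}. \<Union>b'\<in>\<rho> `` {b}. \<rho> `` {a' \<otimes> b'})"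
    unfolding quotient_monoid_def monoid.simps ..
  also have "\<dots> = (\<Union>a'\<in>\<rho> `` {a}. \<Union>b'\<in>\<rho> `` {b}. \<rho> `` {a \<otimes> b})"
    by (intro SUP_cong refl eq)
  also have "\<dots> = \<rho> `` {a \<otimes> b}"
    using ne by (simp only: UN_constant if_False)
  finally show ?thesis .
qed

lemma (in monoid) monoid_quotient_monoid:
  assumes c: "congruence_on G \<rho>"
  shows "monoid (quotient_monoid G \<rho>)"
  by (rule monoidI)
    (auto simp: carrier_quotient_monoid one_quotient_monoid mult_quotient_monoid[OF c] m_assoc)

section \<open>The maximal group image of an inverse monoid\<close>

context inverse_monoid
begin

text \<open>A group has no idempotent except its identity, and conversely the inverse of the monoid
  becomes a group inverse once the idempotents \<open>a a\<^sup>-\<^sup>1\<close> and \<open>a\<^sup>-\<^sup>1 a\<close> collapse. In this form the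
  condition is visibly stable under intersections, which yields the least group congruence.\<close>

lemma group_congruence_iff:
  "group_congruence M \<rho> \<longleftrightarrow>
    congruence_on M \<rho> \<and> (\<forall>a\<in>carrier M. (a \<otimes> sinv M a, \<one>) \<in> \<rho> \<and> (sinv M a \<otimes> a, \<one>) \<in> \<rho>)"
proof (cases "congruence_on M \<rho>")
  case c: True
  interpret Q: monoid "quotient_monoid M \<rho>" by (rule monoid_quotient_monoid[OF c])
  note q = carrier_quotient_monoid one_quotient_monoid mult_quotient_monoid[OF c]
  show ?thesis
  proof
    assume "group_congruence M \<rho>"
    then interpret Q: group "quotient_monoid M \<rho>" by (simp add: group_congruence_def)
    have idem: "(e, \<one>) \<in> \<rho>" if e: "e \<in> carrier M" "e \<otimes> e = e" for e
    proof -
      have "\<rho> `` {e} \<otimes>\<^bsub>quotient_monoid M \<rho>\<^esub> \<rho> `` {e} = \<rho> `` {e}"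
        using e by (simp add: q)
      moreover have "\<rho> `` {e} \<in> carrier (quotient_monoid M \<rho>)" using e by (simp add: q)
      ultimately have "\<rho> `` {e} = \<rho> `` {\<one>}"
        using Q.l_cancel_one[of "\<rho> `` {e}" "\<rho> `` {e}"] by (simp add: q)
      then show ?thesis using e c by (simp add: congruence_class_eq_iff)
    qed
    show "congruence_on M \<rho> \<and> (\<forall>a\<in>carrier M. (a \<otimes> sinv M a, \<one>) \<in> \<rho> \<and> (sinv M a \<otimes> a, \<one>) \<in> \<rho>)"
      using c by (auto intro!: idem simp: idem_mult_sinv idem_sinv_mult)
  next
    assume h: "congruence_on M \<rho> \<and> (\<forall>a\<in>carrier M. (a \<otimes> sinv M a, \<one>) \<in> \<rho> \<and> (sinv M a \<otimes> a, \<one>) \<in> \<rho>)"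
    have "\<exists>B\<in>carrier (quotient_monoid M \<rho>). B \<otimes>\<^bsub>quotient_monoid M \<rho>\<^esub> A = \<one>\<^bsub>quotient_monoid M \<rho>\<^esub>"
      if "A \<in> carrier (quotient_monoid M \<rho>)" for A
    proof -
      from that obtain a where a: "a \<in> carrier M" "A = \<rho> `` {a}" by (auto simp: q)
      then have "\<rho> `` {sinv M a} \<otimes>\<^bsub>quotient_monoid M \<rho>\<^esub> A = \<one>\<^bsub>quotient_monoid M \<rho>\<^esub>"
        using h by (simp add: q congruence_class_eq_iff[OF c])
      then show ?thesis using a by (auto simp: carrier_quotient_monoid)
    qed
    then have "group (quotient_monoid M \<rho>)"
      by (intro groupI) (auto simp: Q.m_assoc)
    then show "group_congruence M \<rho>" using c by (simp add: group_congruence_def)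
  qed
qed (simp add: group_congruence_def)

lemma least_group_congruence_group_congruence:
  "group_congruence M (least_group_congruence M)"
proof -
  let ?G = "{\<rho>. group_congruence M \<rho>}"
  have ne: "?G \<noteq> {}"
    using congruence_on_universal group_congruence_iff by fastforce
  then have "congruence_on M (\<Inter>?G)"
    by (intro congruence_on_Inter) (auto simp: group_congruence_def)
  then have I: "group_congruence M (\<Inter>?G)"
    by (auto simp: group_congruence_iff)
  have "least_group_congruence M = \<Inter>?G"
    unfolding least_group_congruence_def by (rule Least_equality) (use I in auto)
  then show ?thesis using I by simp
qed

text \<open>Left translation by any element is injective on the maximal group image, and hence on any
  set that embeds in the maximal group image.\<close>

lemma inj_on_left_translation:
  assumes inj: "R1_injective M" and s: "s \<in> carrier M"
  shows "inj_on (\<lambda>m. s \<otimes> m) (R_class M \<one>)"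
proof (rule inj_onI)
  fix m n assume mn: "m \<in> R_class M \<one>" "n \<in> R_class M \<one>" "s \<otimes> m = s \<otimes> n"
  let ?\<sigma> = "least_group_congruence M"
  note g = least_group_congruence_group_congruence[unfolded group_congruence_iff]
  have c: "congruence_on M ?\<sigma>" using g by simp
  have mc: "m \<in> carrier M" "n \<in> carrier M" using mn R_class_closed by auto
  have cancel: "(sinv M s \<otimes> s \<otimes> k, k) \<in> ?\<sigma>" if k: "k \<in> carrier M" for k
    using congruence_on_mult[OF c, of "sinv M s \<otimes> s" \<one> k k] g s k congruence_on_refl[OF c k]
    by simp
  have "sinv M s \<otimes> s \<otimes> m = sinv M s \<otimes> s \<otimes> n"
    using mn(3) s mc by (simp add: m_assoc)
  then have "(m, n) \<in> ?\<sigma>"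
    using cancel[OF mc(1)] cancel[OF mc(2)] congruence_on_sym[OF c] congruence_on_trans[OF c]
    by metis
  then have "?\<sigma> `` {m} = ?\<sigma> `` {n}"
    using mc by (simp add: congruence_class_eq_iff[OF c])
  then show "m = n"
    using inj mn by (auto simp: R1_injective_def R_one_eq dest: inj_onD)
qed

end

section \<open>Presented inverse monoids\<close>

lemma inv_letter_inv_letter [simp]: "inv_letter (inv_letter l) = l"
  by (cases l) simp_all

lemma inv_word_inv_word [simp]: "inv_word (inv_word u) = u"
  by (simp add: inv_word_def rev_map comp_def)

lemma inv_word_Nil [simp]: "inv_word [] = []"
  by (simp add: inv_word_def)

lemma inv_word_Cons: "inv_word (l # u) = inv_word u @ [inv_letter l]"
  by (simp add: inv_word_def)

lemma words_Nil [simp]: "[] \<in> words X"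
  by (simp add: words_def)

lemma words_append [simp]: "u @ v \<in> words X \<longleftrightarrow> u \<in> words X \<and> v \<in> words X"
  by (simp add: words_def)

lemma words_Cons: "l # u \<in> words X \<longleftrightarrow> (l \<in> Pos ` X \<union> Neg ` X) \<and> u \<in> words X"
  by (simp add: words_def)

lemma inv_word_words [simp]: "u \<in> words X \<Longrightarrow> inv_word u \<in> words X"
  by (induction u) (auto simp: inv_word_Cons words_Cons)

lemma monoid_word_monoid: "monoid (word_monoid X)"
  by (rule monoidI) (auto simp: word_monoid_def)

lemma carrier_word_monoid: "carrier (word_monoid X) = words X"
  by (simp add: word_monoid_def)

lemma mult_word_monoid: "u \<otimes>\<^bsub>word_monoid X\<^esub> v = u @ v"
  by (simp add: word_monoid_def)

lemma congruence_on_vagner: "congruence_on (word_monoid X) (vagner_congruence X)"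
  unfolding vagner_congruence_def
  by (rule monoid.congruence_on_generated[OF monoid_word_monoid])
    (auto simp: vagner_relations_def carrier_word_monoid)

lemma monoid_free_inverse_monoid: "monoid (free_inverse_monoid X)"
  unfolding free_inverse_monoid_def
  by (rule monoid.monoid_quotient_monoid[OF monoid_word_monoid congruence_on_vagner])

lemma carrier_free_inverse_monoid: "carrier (free_inverse_monoid X) = fim_val X ` words X"
  by (simp add: free_inverse_monoid_def carrier_quotient_monoid carrier_word_monoid fim_val_def)

lemma fim_val_eq_iff:
  "u \<in> words X \<Longrightarrow> v \<in> words X \<Longrightarrow> fim_val X u = fim_val X v \<longleftrightarrow> (u, v) \<in> vagner_congruence X"
  unfolding fim_val_def
  by (rule congruence_class_eq_iff[OF congruence_on_vagner]) (simp_all add: carrier_word_monoid)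

lemma fim_val_append:
  assumes "u \<in> words X" "v \<in> words X"
  shows "fim_val X u \<otimes>\<^bsub>free_inverse_monoid X\<^esub> fim_val X v = fim_val X (u @ v)"
  unfolding free_inverse_monoid_def fim_val_def
  using monoid.mult_quotient_monoid[OF monoid_word_monoid congruence_on_vagner, of u X v] assms
  by (simp add: carrier_word_monoid mult_word_monoid)

locale presentation =
  fixes X :: "'x set" and R :: "'x letter list rel" and M (structure)
  assumes relations: "R \<subseteq> words X \<times> words X"
    and M_def: "M = presented_monoid X R"
begin

lemma congruence_on_presentation:
  "congruence_on (free_inverse_monoid X) (presentation_congruence X R)"
  unfolding presentation_congruence_def
  by (rule monoid.congruence_on_generated[OF monoid_free_inverse_monoid])
    (use relations in \<open>auto simp: carrier_free_inverse_monoid\<close>)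

lemma carrier_M: "carrier M = val X R ` words X"
  by (auto simp: M_def presented_monoid_def carrier_quotient_monoid carrier_free_inverse_monoid
      val_def image_iff)

lemma val_closed [simp]: "u \<in> words X \<Longrightarrow> val X R u \<in> carrier M"
  by (simp add: carrier_M)

lemma val_append:
  assumes "u \<in> words X" "v \<in> words X"
  shows "val X R (u @ v) = val X R u \<otimes> val X R v"
  unfolding M_def presented_monoid_def val_def
  using monoid.mult_quotient_monoid[OF monoid_free_inverse_monoid congruence_on_presentation,
      of "fim_val X u" "fim_val X v"] assms
  by (simp add: carrier_free_inverse_monoid fim_val_append)

lemma val_Nil: "val X R [] = \<one>"
  by (simp add: M_def presented_monoid_def val_def one_quotient_monoid fim_val_def
      free_inverse_monoid_def word_monoid_def)

lemma val_eq_if_relation: "(u, v) \<in> R \<Longrightarrow> val X R u = val X R v"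
  unfolding val_def
  by (rule equiv_class_eq[OF congruence_on_equiv[OF congruence_on_presentation]])
    (unfold presentation_congruence_def, rule subsetD[OF generated_congruence_base], force)

lemma val_eq_if_vagner: "(u, v) \<in> vagner_relations X \<Longrightarrow> val X R u = val X R v"
proof -
  assume "(u, v) \<in> vagner_relations X"
  then have "(u, v) \<in> vagner_congruence X"
    using generated_congruence_base by (auto simp: vagner_congruence_def)
  moreover from this have "u \<in> words X" "v \<in> words X"
    using congruence_on_carrier[OF congruence_on_vagner] by (auto simp: carrier_word_monoid)
  ultimately show ?thesis by (simp add: val_def flip: fim_val_eq_iff)
qed

text \<open>The universal property of the presentation: two words have the same value only if they
  are identified by every congruence that contains the defining relations. Below such
  congruences come from graphs in which words can be read.\<close>

lemma val_eq_imp_congruent: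
  assumes c: "congruence_on (word_monoid X) \<rho>" and V: "vagner_relations X \<subseteq> \<rho>" and R: "R \<subseteq> \<rho>"
    and uv: "u \<in> words X" "v \<in> words X" "val X R u = val X R v"
  shows "(u, v) \<in> \<rho>"
proof -
  have V': "vagner_congruence X \<subseteq> \<rho>"
    unfolding vagner_congruence_def by (rule generated_congruence_least[OF c V])
  have \<rho>w: "a \<in> words X \<and> b \<in> words X" if "(a, b) \<in> \<rho>" for a b
    using congruence_on_carrier[OF c that] by (simp add: carrier_word_monoid)
  have fim: "(a, b) \<in> \<rho>" if "a \<in> words X" "b \<in> words X" "fim_val X a = fim_val X b" for a b
    using that V' by (auto simp: fim_val_eq_iff)
  (* The congruence induced by \<rho> on the free inverse monoid, seen as the first quotient. *)
  define \<rho>' where "\<rho>' = (\<lambda>(a, b). (fim_val X a, fim_val X b)) ` \<rho>"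
  have \<rho>'_iff: "(fim_val X a, fim_val X b) \<in> \<rho>' \<longleftrightarrow> (a, b) \<in> \<rho>"
    if ab: "a \<in> words X" "b \<in> words X" for a b
  proof
    assume "(fim_val X a, fim_val X b) \<in> \<rho>'"
    then obtain a' b' where *: "(a', b') \<in> \<rho>" "fim_val X a = fim_val X a'" "fim_val X b = fim_val X b'"
      by (auto simp: \<rho>'_def)
    have "(a, a') \<in> \<rho>" "(b', b) \<in> \<rho>"
      using fim[of a a'] fim[of b' b] \<rho>w[OF *(1)] ab *(2,3) by simp_all
    then show "(a, b) \<in> \<rho>" using *(1) congruence_on_trans[OF c] by blast
  qed (auto simp: \<rho>'_def)
  have sub: "\<rho>' \<subseteq> carrier (free_inverse_monoid X) \<times> carrier (free_inverse_monoid X)"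
    using \<rho>w by (auto simp: \<rho>'_def carrier_free_inverse_monoid)
  have rep: "\<exists>a b. a \<in> words X \<and> b \<in> words X \<and> A = fim_val X a \<and> B = fim_val X b"
    if "(A, B) \<in> \<rho>'" for A B
    using subsetD[OF sub that] by (auto simp: carrier_free_inverse_monoid)
  have "congruence_on (free_inverse_monoid X) \<rho>'"
  proof (rule congruence_onI[OF sub])
    show "(A, A) \<in> \<rho>'" if "A \<in> carrier (free_inverse_monoid X)" for A
      using that congruence_on_refl[OF c]
      by (auto simp: carrier_free_inverse_monoid carrier_word_monoid \<rho>'_iff)
    show "(B, A) \<in> \<rho>'" if "(A, B) \<in> \<rho>'" for A B
      using rep[OF that] that congruence_on_sym[OF c] by (auto simp: \<rho>'_iff)
    show "(A, C) \<in> \<rho>'" if AB: "(A, B) \<in> \<rho>'" and CD: "(B, C) \<in> \<rho>'" for A B C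
    proof -
      obtain a b where ab: "a \<in> words X" "b \<in> words X" "A = fim_val X a" "B = fim_val X b"
        using rep[OF AB] by blast
      obtain d where d: "d \<in> words X" "C = fim_val X d" using rep[OF CD] by blast
      show ?thesis using AB CD ab d congruence_on_trans[OF c] by (auto simp: \<rho>'_iff)
    qed
    show "(A \<otimes>\<^bsub>free_inverse_monoid X\<^esub> C, B \<otimes>\<^bsub>free_inverse_monoid X\<^esub> D) \<in> \<rho>'"
      if AB: "(A, B) \<in> \<rho>'" and CD: "(C, D) \<in> \<rho>'" for A B C D
    proof -
      obtain a b where ab: "a \<in> words X" "b \<in> words X" "A = fim_val X a" "B = fim_val X b"
        using rep[OF AB] by blast
      obtain e d where ed: "e \<in> words X" "d \<in> words X" "C = fim_val X e" "D = fim_val X d"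
        using rep[OF CD] by blast
      have "(a @ e, b @ d) \<in> \<rho>"
        using AB CD ab ed congruence_on_mult[OF c, of a b e d] by (simp add: \<rho>'_iff mult_word_monoid)
      then show ?thesis
        using ab ed by (simp add: fim_val_append \<rho>'_iff)
    qed
  qed
  moreover have "(\<lambda>(u, v). (fim_val X u, fim_val X v)) ` R \<subseteq> \<rho>'"
    using R by (auto simp: \<rho>'_def)
  ultimately have "presentation_congruence X R \<subseteq> \<rho>'"
    unfolding presentation_congruence_def by (rule generated_congruence_least)
  moreover have "(fim_val X u, fim_val X v) \<in> presentation_congruence X R"
    using uv congruence_class_eq_iff[OF congruence_on_presentation, of "fim_val X u" "fim_val X v"]
    by (simp add: val_def carrier_free_inverse_monoid)
  ultimately show ?thesis using \<rho>'_iff uv by blast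
qed

lemma val_inv_word:
  assumes u: "u \<in> words X"
  shows "val X R u \<otimes> val X R (inv_word u) \<otimes> val X R u = val X R u"
proof -
  have "(u @ inv_word u @ u, u) \<in> vagner_relations X"
    using u by (auto simp: vagner_relations_def)
  from val_eq_if_vagner[OF this] u show ?thesis
    by (simp add: val_append flip: append_assoc)
qed

sublocale monoid M
  unfolding M_def presented_monoid_def
  by (rule monoid.monoid_quotient_monoid[OF monoid_free_inverse_monoid congruence_on_presentation])

sublocale inverse_monoid M
proof (rule inverse_monoid_if_commuting_idempotents)
  let ?E = "{val X R (u @ inv_word u) | u. u \<in> words X}"
  show "?E \<subseteq> carrier M" by auto
  show "e \<otimes> f = f \<otimes> e" if "e \<in> ?E" "f \<in> ?E" for e f
  proof -
    from that obtain u v where uv: "u \<in> words X" "v \<in> words X"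
      "e = val X R (u @ inv_word u)" "f = val X R (v @ inv_word v)" by blast
    have "(u @ inv_word u @ v @ inv_word v, v @ inv_word v @ u @ inv_word u) \<in> vagner_relations X"
      using uv(1,2) unfolding vagner_relations_def by blast
    from val_eq_if_vagner[OF this] show ?thesis
      using uv by (simp add: m_assoc val_append)
  qed
  show "\<exists>b\<in>carrier M. a \<otimes> b \<otimes> a = a \<and> b \<otimes> a \<otimes> b = b \<and> a \<otimes> b \<in> ?E \<and> b \<otimes> a \<in> ?E"
    if "a \<in> carrier M" for a
  proof -
    from that obtain u where u: "u \<in> words X" "a = val X R u" by (auto simp: carrier_M)
    have "a \<otimes> val X R (inv_word u) \<in> ?E"
      using u by (auto simp: val_append intro!: exI[of _ u])
    moreover have "val X R (inv_word u) \<otimes> a \<in> ?E"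
      using u by (auto simp: val_append intro!: exI[of _ "inv_word u"])
    ultimately show ?thesis
      using u val_inv_word[of u] val_inv_word[of "inv_word u"]
      by (intro bexI[of _ "val X R (inv_word u)"]) simp_all
  qed
qed

lemma sinv_val: "u \<in> words X \<Longrightarrow> sinv M (val X R u) = val X R (inv_word u)"
  using val_inv_word[of u] val_inv_word[of "inv_word u"] by (intro sinv_eqI) simp_all

end

section \<open>Reading words in labelled graphs\<close>

lemma verts_lgraph [simp]: "verts (lgraph V E) = V"
  and arcs_lgraph [simp]: "arcs (lgraph V E) = E"
  by (simp_all add: lgraph_def)

lemma labelled_path_Nil:
  "labelled_path G a [] p b \<longleftrightarrow> p = [] \<and> a = b \<and> a \<in> verts G"
  by (auto elim: labelled_path.cases intro: labelled_path.intros)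

lemma labelled_path_Pos:
  "labelled_path G a (Pos x # u) p b \<longleftrightarrow>
    (\<exists>c q. p = (a, x, c) # q \<and> (a, x, c) \<in> arcs G \<and> labelled_path G c u q b)"
  by (auto elim: labelled_path.cases intro: labelled_path.intros)

lemma labelled_path_Neg:
  "labelled_path G a (Neg x # u) p b \<longleftrightarrow>
    (\<exists>c q. p = (c, x, a) # q \<and> (c, x, a) \<in> arcs G \<and> labelled_path G c u q b)"
  by (auto elim: labelled_path.cases intro: labelled_path.intros)

lemma labelled_path_arcs: "labelled_path G a u p b \<Longrightarrow> set p \<subseteq> arcs G"
  by (induction rule: labelled_path.induct) auto

lemma labelled_path_end: "labelled_path G a u p b \<Longrightarrow> b \<in> verts G"
  by (induction rule: labelled_path.induct) auto

lemma labelled_path_transfer: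
  "labelled_path G a u p b \<Longrightarrow> set p \<subseteq> arcs H \<Longrightarrow> b \<in> verts H \<Longrightarrow> labelled_path H a u p b"
  by (induction rule: labelled_path.induct) (auto intro: labelled_path.intros)

lemma labelled_path_map:
  assumes "f ` verts G \<subseteq> verts H" "map_edge f ` arcs G \<subseteq> arcs H"
  shows "labelled_path G a u p b \<Longrightarrow> labelled_path H (f a) u (map (map_edge f) p) (f b)"
proof (induction rule: labelled_path.induct)
  case (empty v)
  then show ?case using assms(1) by (auto intro: labelled_path.empty)
next
  case (forward u x u' w p v)
  have "map_edge f (u, x, u') \<in> arcs H"
    using forward assms(2) by blast
  then show ?case
    using forward by (simp add: map_edge_def labelled_path.forward)
next
  case (backward u' x u w p v)
  have "map_edge f (u', x, u) \<in> arcs H"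
    using backward assms(2) by blast
  then show ?case
    using backward by (simp add: map_edge_def labelled_path.backward)
qed

text \<open>The path visits only vertices that are reached by prefixes of its label.\<close>

lemma labelled_path_edge_ends:
  assumes "labelled_path G a u p b" "(c, x, d) \<in> set p"
    and "a \<in> verts G" and ends: "\<And>a x b. (a, x, b) \<in> arcs G \<Longrightarrow> a \<in> verts G \<and> b \<in> verts G"
  shows "(\<exists>u' q. prefix u' u \<and> labelled_path G a u' q c) \<and>
    (\<exists>u' q. prefix u' u \<and> labelled_path G a u' q d)"
  using assms(1-3)
proof (induction rule: labelled_path.induct)
  case (empty v)
  then show ?case by simp
next
  case (forward u y u' w p v)
  have u': "u' \<in> verts G" using forward ends by blast
  have start: "\<exists>u'' q. prefix u'' (Pos y # w) \<and> labelled_path G u u'' q u"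
    using forward by (intro exI[of _ "[]"]) (auto intro: labelled_path.empty)
  have "labelled_path G u [Pos y] [(u, y, u')] u'"
    using forward u' by (auto intro: labelled_path.intros)
  then have next1: "\<exists>u'' q. prefix u'' (Pos y # w) \<and> labelled_path G u u'' q u'"
    by (intro exI[of _ "[Pos y]"]) auto
  have step: "\<exists>u'' q. prefix u'' (Pos y # w) \<and> labelled_path G u u'' q e"
    if "\<exists>u'' q. prefix u'' w \<and> labelled_path G u' u'' q e" for e
    using that forward(1) by (metis Cons_prefix_Cons labelled_path.forward)
  show ?case
  proof (cases "(c, x, d) \<in> set p")
    case True
    then show ?thesis using forward.IH u' step by blast
  next
    case False
    then show ?thesis using forward.prems start next1 by auto
  qed
next
  case (backward u' y u w p v)
  have u': "u' \<in> verts G" using backward ends by blast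
  have start: "\<exists>u'' q. prefix u'' (Neg y # w) \<and> labelled_path G u u'' q u"
    using backward by (intro exI[of _ "[]"]) (auto intro: labelled_path.empty)
  have "labelled_path G u [Neg y] [(u', y, u)] u'"
    using backward u' by (auto intro: labelled_path.intros)
  then have next1: "\<exists>u'' q. prefix u'' (Neg y # w) \<and> labelled_path G u u'' q u'"
    by (intro exI[of _ "[Neg y]"]) auto
  have step: "\<exists>u'' q. prefix u'' (Neg y # w) \<and> labelled_path G u u'' q e"
    if "\<exists>u'' q. prefix u'' w \<and> labelled_path G u' u'' q e" for e
    using that backward(1) by (metis Cons_prefix_Cons labelled_path.backward)
  show ?case
  proof (cases "(c, x, d) \<in> set p")
    case True
    then show ?thesis using backward.IH u' step by blast
  next
    case False
    then show ?thesis using backward.prems start next1 by auto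
  qed
qed

definition reads :: "('v, 'x) lgraph \<Rightarrow> 'v \<Rightarrow> 'x letter list \<Rightarrow> 'v \<Rightarrow> bool" where
  "reads G a u b \<longleftrightarrow> (\<exists>p. labelled_path G a u p b)"

lemma reads_Nil [simp]: "reads G a [] b \<longleftrightarrow> a = b \<and> a \<in> verts G"
  by (simp add: reads_def labelled_path_Nil)

lemma reads_Pos: "reads G a (Pos x # u) b \<longleftrightarrow> (\<exists>c. (a, x, c) \<in> arcs G \<and> reads G c u b)"
  by (auto simp: reads_def labelled_path_Pos)

lemma reads_Neg: "reads G a (Neg x # u) b \<longleftrightarrow> (\<exists>c. (c, x, a) \<in> arcs G \<and> reads G c u b)"
  by (auto simp: reads_def labelled_path_Neg)

lemma reads_end: "reads G a u b \<Longrightarrow> b \<in> verts G"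
  by (auto simp: reads_def labelled_path_end)

lemma reads_mono:
  "reads G a u b \<Longrightarrow> verts G \<subseteq> verts H \<Longrightarrow> arcs G \<subseteq> arcs H \<Longrightarrow> reads H a u b"
  unfolding reads_def
  by (meson labelled_path_arcs labelled_path_end labelled_path_transfer subset_iff)

lemma reads_map:
  "reads G a u b \<Longrightarrow> f ` verts G \<subseteq> verts H \<Longrightarrow> map_edge f ` arcs G \<subseteq> arcs H \<Longrightarrow> reads H (f a) u (f b)"
  unfolding reads_def by (elim exE, rule exI, rule labelled_path_map)

locale wf_labelled_graph =
  fixes G :: "('v, 'x) lgraph"
  assumes ends: "(a, x, b) \<in> arcs G \<Longrightarrow> a \<in> verts G \<and> b \<in> verts G"
begin

lemma reads_start: "reads G a u b \<Longrightarrow> a \<in> verts G"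
proof (cases u)
  case (Cons l v)
  then show "reads G a u b \<Longrightarrow> a \<in> verts G"
    by (cases l) (auto simp: reads_Pos reads_Neg dest: ends)
qed auto

lemma reads_append: "reads G a (u @ v) c \<longleftrightarrow> (\<exists>b. reads G a u b \<and> reads G b v c)"
proof (induction u arbitrary: a)
  case Nil
  then show ?case using reads_start by auto
next
  case (Cons l u)
  then show ?case by (cases l) (auto simp: reads_Pos reads_Neg)
qed

lemma reads_inv_letter: "reads G a [l] b \<Longrightarrow> reads G b [inv_letter l] a"
  by (cases l) (auto simp: reads_Pos reads_Neg dest: ends)

lemma reads_inv_word: "reads G a u b \<Longrightarrow> reads G b (inv_word u) a"
proof (induction u arbitrary: a)
  case (Cons l u)
  then have "reads G a ([l] @ u) b" by simp
  then obtain c where c: "reads G a [l] c" "reads G c u b" unfolding reads_append by blast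
  then show ?case
    using Cons.IH[OF c(2)] reads_inv_letter[OF c(1)] unfolding inv_word_Cons reads_append by blast
qed (simp add: inv_word_def)

end

text \<open>Letters may be read against the direction of an edge, so reading words is the same as
  walking in the underlying undirected graph.\<close>

lemma connected_iff_reads:
  fixes V :: "'v set" and E :: "('v, 'x) edge set"
  assumes "wf_labelled_graph (lgraph V E)"
  shows "Digraph_Component.connected (lgraph V E) \<longleftrightarrow>
    V \<noteq> {} \<and> (\<forall>a\<in>V. \<forall>b\<in>V. \<exists>u. reads (lgraph V E) a u b)"
proof -
  interpret wf_labelled_graph "lgraph V E" by fact
  let ?G = "lgraph V E"
  let ?S = "with_proj (mk_symmetric ?G)"
  have ends_S: "(a, b) \<in> arcs_ends ?S \<longleftrightarrow> (\<exists>x. (a, x, b) \<in> E \<or> (b, x, a) \<in> E)" for a b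
  proof -
    have "arcs_ends ?S = parcs (mk_symmetric ?G)" by (simp add: arcs_ends_conv)
    then show ?thesis by (force simp: parcs_mk_symmetric lgraph_def)
  qed
  have "a \<rightarrow>\<^sup>*\<^bsub>?S\<^esub> b \<longleftrightarrow> (\<exists>u. reads ?G a u b)" for a b
  proof
    assume "a \<rightarrow>\<^sup>*\<^bsub>?S\<^esub> b"
    then show "\<exists>u. reads ?G a u b"
      unfolding reachable_def
    proof (induction rule: converse_rtrancl_on_induct)
      case base
      then show ?case by (intro exI[of _ "[]"]) simp
    next
      case (step y z)
      then obtain u where u: "reads ?G z u b" by blast
      from step obtain x where "(y, x, z) \<in> E \<or> (z, x, y) \<in> E" using ends_S by blast
      then show ?case
        using u by (metis arcs_lgraph reads_Neg reads_Pos)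
    qed
  next
    assume "\<exists>u. reads ?G a u b"
    then obtain u where "reads ?G a u b" by blast
    then show "a \<rightarrow>\<^sup>*\<^bsub>?S\<^esub> b"
      unfolding reachable_def
    proof (induction u arbitrary: a)
      case (Cons l u)
      then obtain c x where "(a, x, c) \<in> E \<or> (c, x, a) \<in> E" "reads ?G c u b"
        by (cases l) (auto simp: reads_Pos reads_Neg)
      then show ?case
        using Cons.IH[of c] ends[of a _ c] ends[of c _ a] ends_S[of a c]
        by (auto intro: converse_rtrancl_on_into_rtrancl_on)
    qed simp
  qed
  then show ?thesis
    by (simp add: connected_def strongly_connected_def)
qed

locale bideterministic_graph = wf_labelled_graph +
  assumes det: "(a, x, b) \<in> arcs G \<Longrightarrow> (a, x, c) \<in> arcs G \<Longrightarrow> b = c"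
    and codet: "(b, x, a) \<in> arcs G \<Longrightarrow> (c, x, a) \<in> arcs G \<Longrightarrow> b = c"
begin

lemma reads_deterministic: "reads G a u b \<Longrightarrow> reads G a u c \<Longrightarrow> b = c"
proof (induction u arbitrary: a)
  case (Cons l u)
  then show ?case
    by (cases l) (auto simp: reads_Pos reads_Neg dest: det codet)
qed simp

lemma reads_append_inv_word: "reads G a (u @ inv_word u) b \<longleftrightarrow> a = b \<and> (\<exists>c. reads G a u c)"
proof
  assume "reads G a (u @ inv_word u) b"
  then obtain c where c: "reads G a u c" "reads G c (inv_word u) b" by (auto simp: reads_append)
  then show "a = b \<and> (\<exists>c. reads G a u c)"
    using reads_inv_word reads_deterministic by blast
qed (auto simp: reads_append dest: reads_inv_word)

text \<open>The words over \<open>X\<close> act on the vertices of a bi-deterministic graph by partial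
  injections, so this action satisfies the relations of the free inverse monoid; and it satisfies
  a relation \<open>r = 1\<close> as soon as \<open>r\<close> labels a loop at every vertex. It then factors through the
  inverse monoid defined by such relations.\<close>

lemma reads_val_cong:
  assumes R: "special_presentation X R"
    and loops: "\<And>r v. (r, []) \<in> R \<Longrightarrow> v \<in> verts G \<Longrightarrow> reads G v r v"
    and uv: "u \<in> words X" "v \<in> words X" "val X R u = val X R v"
  shows "reads G a u b \<longleftrightarrow> reads G a v b"
proof -
  define \<rho> where "\<rho> = {(u, v). u \<in> words X \<and> v \<in> words X \<and> (\<forall>a b. reads G a u b \<longleftrightarrow> reads G a v b)}"
  interpret presentation X R "presented_monoid X R"
    using R by unfold_locales (auto simp: special_presentation_def)
  have "congruence_on (word_monoid X) \<rho>"
    by (rule congruence_onI) (auto simp: \<rho>_def carrier_word_monoid mult_word_monoid reads_append)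
  moreover have "vagner_relations X \<subseteq> \<rho>"
  proof -
    have 1: "reads G a (u @ inv_word u @ u) b \<longleftrightarrow> reads G a u b" for u a b
      using reads_append[of a "u @ inv_word u" u b] by (auto simp: reads_append_inv_word)
    have 2: "reads G a (u @ inv_word u @ v @ inv_word v) b \<longleftrightarrow>
        a = b \<and> (\<exists>c. reads G a u c) \<and> (\<exists>c. reads G a v c)" for u v a b
      using reads_append[of a "u @ inv_word u" "v @ inv_word v" b]
      by (auto simp: reads_append_inv_word)
    show ?thesis
      by (auto simp: vagner_relations_def \<rho>_def 1 2)
  qed
  moreover have "R \<subseteq> \<rho>"
  proof (rule subrelI)
    fix r v assume r: "(r, v) \<in> R"
    then have v: "v = []" "r \<in> words X" using R by (auto simp: special_presentation_def)
    have "reads G a r b \<longleftrightarrow> a = b \<and> a \<in> verts G" for a b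
      using loops[of r a] r v reads_deterministic[of a r a b] reads_start[of a r b] by auto
    then show "(r, v) \<in> \<rho>" using v by (simp add: \<rho>_def)
  qed
  ultimately have "(u, v) \<in> \<rho>"
    using uv by (rule val_eq_imp_congruent)
  then show ?thesis by (simp add: \<rho>_def)
qed

end

text \<open>The double cover of \<open>G\<close> in which exactly the edge \<open>e\<close> changes the sheet: the end of the lift
  of a path shows the parity of the number of times that the path traverses \<open>e\<close>.\<close>

definition double_cover :: "('v, 'x) lgraph \<Rightarrow> ('v, 'x) edge \<Rightarrow> ('v \<times> bool, 'x) lgraph" where
  "double_cover G e = lgraph (verts G \<times> UNIV)
     {((a, i), x, (b, i \<noteq> ((a, x, b) = e))) | a x b i. (a, x, b) \<in> arcs G}"

lemma arcs_double_cover: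
  "((a, i), x, (b, j)) \<in> arcs (double_cover G e) \<longleftrightarrow>
    (a, x, b) \<in> arcs G \<and> (j \<longleftrightarrow> i \<noteq> ((a, x, b) = e))"
  by (auto simp: double_cover_def)

lemma verts_double_cover: "verts (double_cover G e) = verts G \<times> UNIV"
  by (simp add: double_cover_def)

lemma (in bideterministic_graph) bideterministic_double_cover:
  "bideterministic_graph (double_cover G e)"
proof unfold_locales
  fix a x b c
  show "(a, x, b) \<in> arcs (double_cover G e) \<Longrightarrow>
      a \<in> verts (double_cover G e) \<and> b \<in> verts (double_cover G e)"
    by (cases a; cases b) (auto simp: arcs_double_cover verts_double_cover dest: ends)
  show "(a, x, b) \<in> arcs (double_cover G e) \<Longrightarrow> (a, x, c) \<in> arcs (double_cover G e) \<Longrightarrow> b = c"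
    by (cases a; cases b; cases c) (auto simp: arcs_double_cover dest: det)
  show "(b, x, a) \<in> arcs (double_cover G e) \<Longrightarrow> (c, x, a) \<in> arcs (double_cover G e) \<Longrightarrow> b = c"
    by (cases a; cases b; cases c) (auto simp: arcs_double_cover dest: codet)
qed

lemma labelled_path_avoiding_lifts:
  "labelled_path G a u p b \<Longrightarrow> e \<notin> set p \<Longrightarrow> reads (double_cover G e) (a, i) u (b, i)"
proof (induction rule: labelled_path.induct)
  case (empty v)
  then show ?case by (simp add: verts_double_cover)
next
  case (forward u x u' w p v)
  then have "((u, i), x, (u', i)) \<in> arcs (double_cover G e)" by (auto simp: arcs_double_cover)
  then show ?case using forward unfolding reads_Pos by auto
next
  case (backward u' x u w p v)
  then have "((u', i), x, (u, i)) \<in> arcs (double_cover G e)" by (auto simp: arcs_double_cover)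
  then show ?case using backward unfolding reads_Neg by auto
qed

lemma reads_lifts: "reads G a u b \<Longrightarrow> \<exists>j. reads (double_cover G e) (a, i) u (b, j)"
proof (induction u arbitrary: a i)
  case Nil
  then show ?case by (auto simp: verts_double_cover)
next
  case (Cons l u)
  show ?case
  proof (cases l)
    case (Pos x)
    then obtain c where c: "(a, x, c) \<in> arcs G" "reads G c u b" using Cons.prems by (auto simp: reads_Pos)
    then have "((a, i), x, (c, i \<noteq> ((a, x, c) = e))) \<in> arcs (double_cover G e)"
      by (simp add: arcs_double_cover)
    then show ?thesis using Cons.IH[OF c(2)] unfolding Pos reads_Pos by blast
  next
    case (Neg x)
    then obtain c where c: "(c, x, a) \<in> arcs G" "reads G c u b" using Cons.prems by (auto simp: reads_Neg)
    then have "((c, i \<noteq> ((c, x, a) = e)), x, (a, i)) \<in> arcs (double_cover G e)"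
      by (auto simp: arcs_double_cover)
    then show ?thesis using Cons.IH[OF c(2)] unfolding Neg reads_Neg by blast
  qed
qed

section \<open>Schuetzenberger graphs and their preblocks\<close>

context presentation
begin

lemma verts_schutz_graph: "verts (schutz_graph X R m) = R_class M m"
  by (simp add: schutz_graph_def Let_def M_def)

lemma arcs_schutz_graph:
  "(s, x, t) \<in> arcs (schutz_graph X R m) \<longleftrightarrow>
    s \<in> R_class M m \<and> t \<in> R_class M m \<and> x \<in> X \<and> t = s \<otimes> val X R [Pos x]"
  by (auto simp: schutz_graph_def Let_def M_def)

lemma schutz_graph_lgraph:
  "schutz_graph X R m = lgraph (verts (schutz_graph X R m)) (arcs (schutz_graph X R m))"
  by (simp add: schutz_graph_def Let_def)

lemma arcs_schutz_graph_Neg: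
  assumes m: "m \<in> carrier M"
  shows "(t, x, s) \<in> arcs (schutz_graph X R m) \<longleftrightarrow>
    s \<in> R_class M m \<and> t \<in> R_class M m \<and> x \<in> X \<and> t = s \<otimes> val X R [Neg x]"
proof (cases "x \<in> X \<and> s \<in> R_class M m \<and> t \<in> R_class M m")
  case True
  then have x: "[Pos x] \<in> words X" "[Neg x] \<in> words X" by (auto simp: words_Cons)
  have inv: "sinv M (val X R [Pos x]) = val X R [Neg x]" "sinv M (val X R [Neg x]) = val X R [Pos x]"
    using x by (simp_all add: sinv_val inv_word_Cons)
  show ?thesis
    using True R_class_mult_iff[OF m, of s "val X R [Neg x]"] R_class_mult_iff[OF m, of t "val X R [Pos x]"]
    by (auto simp: arcs_schutz_graph inv x)
qed (auto simp: arcs_schutz_graph)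

lemma bideterministic_schutz_graph:
  assumes m: "m \<in> carrier M"
  shows "bideterministic_graph (schutz_graph X R m)"
proof unfold_locales
  show "a \<in> verts (schutz_graph X R m) \<and> b \<in> verts (schutz_graph X R m)"
    if "(a, x, b) \<in> arcs (schutz_graph X R m)" for a x b
    using that by (auto simp: arcs_schutz_graph verts_schutz_graph)
  show "b = c" if "(a, x, b) \<in> arcs (schutz_graph X R m)" "(a, x, c) \<in> arcs (schutz_graph X R m)" for a x b c
    using that by (simp add: arcs_schutz_graph)
  show "b = c" if "(b, x, a) \<in> arcs (schutz_graph X R m)" "(c, x, a) \<in> arcs (schutz_graph X R m)" for a x b c
    using that by (simp add: arcs_schutz_graph_Neg[OF m])
qed

lemma reads_schutz_graph_words: "reads (schutz_graph X R m) s u t \<Longrightarrow> u \<in> words X"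
proof (induction u arbitrary: s)
  case (Cons l u)
  then show ?case
    by (cases l) (auto simp: reads_Pos reads_Neg words_Cons arcs_schutz_graph)
qed simp

text \<open>The prefixes of \<open>u\<close> cannot leave the R-class if \<open>u\<close> ends in it, so the existence of a path
  labelled \<open>u\<close> depends on its end only.\<close>

lemma reads_schutz_graph_iff:
  assumes m: "m \<in> carrier M"
  shows "u \<in> words X \<Longrightarrow> s \<in> R_class M m \<Longrightarrow>
    reads (schutz_graph X R m) s u t \<longleftrightarrow> t = s \<otimes> val X R u \<and> t \<in> R_class M m"
proof (induction u arbitrary: s)
  case Nil
  then show ?case
    using R_class_closed by (auto simp: val_Nil verts_schutz_graph)
next
  case (Cons l u)
  have sc: "s \<in> carrier M" using Cons.prems(2) by (rule R_class_closed)
  have l: "[l] \<in> words X" and u: "u \<in> words X" using Cons.prems(1) by (auto simp: words_Cons)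
  have "reads (schutz_graph X R m) s (l # u) t \<longleftrightarrow>
      s \<otimes> val X R [l] \<in> R_class M m \<and> reads (schutz_graph X R m) (s \<otimes> val X R [l]) u t"
  proof (cases l)
    case (Pos x)
    then show ?thesis
      using Cons.prems(2) l by (auto simp: reads_Pos arcs_schutz_graph words_Cons)
  next
    case (Neg x)
    then show ?thesis
      using Cons.prems(2) l by (auto simp: reads_Neg arcs_schutz_graph_Neg[OF m] words_Cons)
  qed
  also have "\<dots> \<longleftrightarrow> s \<otimes> val X R [l] \<in> R_class M m \<and> t = s \<otimes> val X R [l] \<otimes> val X R u \<and> t \<in> R_class M m"
    using Cons.IH[OF u] by blast
  also have "\<dots> \<longleftrightarrow> t = s \<otimes> val X R [l] \<otimes> val X R u \<and> t \<in> R_class M m"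
    using R_class_prefix[OF m Cons.prems(2)] l u val_closed by blast
  also have "s \<otimes> val X R [l] \<otimes> val X R u = s \<otimes> val X R (l # u)"
    using val_append[OF l u] sc l u by (simp add: m_assoc)
  finally show ?case .
qed

text \<open>For \<open>s\<close> in an R-class, \<open>preblock_at s\<close> is the image of the Schuetzenberger graph of \<open>1\<close>
  under the only morphism that can send \<open>1\<close> to \<open>s\<close>.\<close>

definition preblock_at :: "'x pres_elem \<Rightarrow> ('x pres_elem, 'x) lgraph" where
  "preblock_at s = image_graph (\<lambda>n. s \<otimes> n) (schutz_graph X R \<one>)"

lemma verts_preblock_at: "verts (preblock_at s) = (\<lambda>n. s \<otimes> n) ` R_class M \<one>"
  by (simp add: preblock_at_def image_graph_def verts_schutz_graph)

lemma arcs_preblock_at: "arcs (preblock_at s) = map_edge (\<lambda>n. s \<otimes> n) ` arcs (schutz_graph X R \<one>)"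
  by (simp add: preblock_at_def image_graph_def)

lemma root_in_preblock_at: "s \<in> carrier M \<Longrightarrow> s \<in> verts (preblock_at s)"
  by (auto simp: verts_preblock_at intro!: image_eqI[of _ _ \<one>])

lemma preblock_at_subset_schutz_graph:
  assumes m: "m \<in> carrier M" and s: "s \<in> R_class M m"
  shows "verts (preblock_at s) \<subseteq> verts (schutz_graph X R m)"
    and "arcs (preblock_at s) \<subseteq> arcs (schutz_graph X R m)"
  using R_class_mult_right_unit[OF m s] s
  by (auto simp: verts_preblock_at arcs_preblock_at verts_schutz_graph arcs_schutz_graph map_edge_def
      m_assoc R_class_closed words_Cons)

text \<open>The reason is that the R-class of \<open>1\<close> is a submonoid: if \<open>t = s n\<close> with \<open>n\<close> in it, then each
  \<open>t k\<close> is \<open>s (n k)\<close>.\<close>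

lemma preblock_at_subset_preblock_at:
  assumes s: "s \<in> carrier M" and t: "t \<in> verts (preblock_at s)"
  shows "verts (preblock_at t) \<subseteq> verts (preblock_at s)"
    and "arcs (preblock_at t) \<subseteq> arcs (preblock_at s)"
proof -
  obtain n where n: "n \<in> R_class M \<one>" "t = s \<otimes> n"
    using t by (auto simp: verts_preblock_at)
  have nk: "n \<otimes> k \<in> R_class M \<one>" "t \<otimes> k = s \<otimes> (n \<otimes> k)" if "k \<in> R_class M \<one>" for k
    using R_class_mult_right_unit[OF one_closed n(1) that] n that s
    by (auto simp: m_assoc R_class_closed)
  show "verts (preblock_at t) \<subseteq> verts (preblock_at s)"
    using nk by (auto simp: verts_preblock_at)
  show "arcs (preblock_at t) \<subseteq> arcs (preblock_at s)"
  proof (rule subrelI)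
    fix a y assume "(a, y) \<in> arcs (preblock_at t)"
    then obtain k x l where k: "(k, x, l) \<in> arcs (schutz_graph X R \<one>)" "(a, y) = (t \<otimes> k, x, t \<otimes> l)"
      by (auto simp: arcs_preblock_at map_edge_def)
    then have kl: "k \<in> R_class M \<one>" "l \<in> R_class M \<one>" "x \<in> X" "l = k \<otimes> val X R [Pos x]"
      by (auto simp: arcs_schutz_graph)
    have "n \<otimes> l = n \<otimes> k \<otimes> val X R [Pos x]"
      using n kl by (simp add: m_assoc R_class_closed words_Cons)
    then have "(n \<otimes> k, x, n \<otimes> l) \<in> arcs (schutz_graph X R \<one>)"
      using kl(3) nk(1)[OF kl(1)] nk(1)[OF kl(2)] by (simp add: arcs_schutz_graph)
    moreover have "(a, y) = map_edge (\<lambda>n. s \<otimes> n) (n \<otimes> k, x, n \<otimes> l)"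
      using k nk kl by (simp add: map_edge_def)
    ultimately show "(a, y) \<in> arcs (preblock_at s)"
      unfolding arcs_preblock_at by blast
  qed
qed

lemma wf_digraph_schutz_graph: "wf_digraph (schutz_graph X R m)"
  by unfold_locales
    (auto simp: schutz_graph_def Let_def lgraph_def)

lemma wf_digraph_preblock_at: "wf_digraph (preblock_at s)"
  by unfold_locales
    (auto simp: preblock_at_def image_graph_def lgraph_def map_edge_def verts_schutz_graph
      arcs_schutz_graph)

lemma subgraph_preblock_at_schutz_graph:
  assumes "m \<in> carrier M" "s \<in> R_class M m"
  shows "subgraph (preblock_at s) (schutz_graph X R m)"
proof -
  have "compatible (schutz_graph X R m) (preblock_at s)"
    by (subst schutz_graph_lgraph)
      (simp add: compatible_def preblock_at_def image_graph_def lgraph_def)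
  then show ?thesis
    using preblock_at_subset_schutz_graph[OF assms] wf_digraph_schutz_graph wf_digraph_preblock_at
    by (simp add: subgraph_def)
qed

lemma subgraph_preblock_at:
  assumes "s \<in> carrier M" "t \<in> verts (preblock_at s)"
  shows "subgraph (preblock_at t) (preblock_at s)"
proof -
  have "compatible (preblock_at s) (preblock_at t)"
    by (simp add: compatible_def preblock_at_def image_graph_def lgraph_def)
  then show ?thesis
    using preblock_at_subset_preblock_at[OF assms] wf_digraph_preblock_at
    by (simp add: subgraph_def)
qed

text \<open>A morphism preserves the reading of words, and every vertex of the Schuetzenberger graph
  of \<open>1\<close> is reached from \<open>1\<close> by reading a word. Thus a morphism is a left translation.\<close>

lemma morphism_eq_left_translation:
  assumes m: "m \<in> carrier M"
    and f: "injective_morphism (schutz_graph X R \<one>) (schutz_graph X R m) f"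
    and n: "n \<in> R_class M \<one>"
  shows "f n = f \<one> \<otimes> n"
proof -
  from n obtain u where u: "u \<in> words X" "n = val X R u"
    using R_class_closed by (auto simp: carrier_M)
  then have "reads (schutz_graph X R \<one>) \<one> u n"
    using n by (simp add: reads_schutz_graph_iff)
  then have "reads (schutz_graph X R m) (f \<one>) u (f n)"
    by (rule reads_map[where f=f]) (use f in \<open>simp_all add: injective_morphism_def\<close>)
  moreover have "f \<one> \<in> R_class M m"
    using f by (auto simp: injective_morphism_def verts_schutz_graph)
  ultimately show ?thesis
    using u by (simp add: reads_schutz_graph_iff[OF m])
qed

lemma image_graph_morphism:
  assumes m: "m \<in> carrier M"
    and f: "injective_morphism (schutz_graph X R \<one>) (schutz_graph X R m) f"
  shows "image_graph f (schutz_graph X R \<one>) = preblock_at (f \<one>)" "f \<one> \<in> R_class M m"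
proof -
  note eq = morphism_eq_left_translation[OF m f]
  have "f ` R_class M \<one> = (\<lambda>n. f \<one> \<otimes> n) ` R_class M \<one>"
    by (intro image_cong refl eq)
  moreover have "map_edge f ` arcs (schutz_graph X R \<one>) = map_edge (\<lambda>n. f \<one> \<otimes> n) ` arcs (schutz_graph X R \<one>)"
  proof (intro image_cong refl)
    fix e assume "e \<in> arcs (schutz_graph X R \<one>)"
    then obtain k x l where e: "e = (k, x, l)" "k \<in> R_class M \<one>" "l \<in> R_class M \<one>"
      by (cases e) (auto simp: arcs_schutz_graph)
    show "map_edge f e = map_edge (\<lambda>n. f \<one> \<otimes> n) e"
      using eq[OF e(2)] eq[OF e(3)] by (simp add: e(1) map_edge_def)
  qed
  ultimately show "image_graph f (schutz_graph X R \<one>) = preblock_at (f \<one>)"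
    by (simp add: preblock_at_def image_graph_def verts_schutz_graph)
  show "f \<one> \<in> R_class M m"
    using f by (auto simp: injective_morphism_def verts_schutz_graph)
qed

lemma injective_morphism_left_translation:
  assumes "R1_injective M" "m \<in> carrier M" "s \<in> R_class M m"
  shows "injective_morphism (schutz_graph X R \<one>) (schutz_graph X R m) (\<lambda>n. s \<otimes> n)"
  using preblock_at_subset_schutz_graph[OF assms(2,3)] inj_on_left_translation[OF assms(1)] assms(3)
  by (simp add: injective_morphism_def verts_preblock_at arcs_preblock_at verts_schutz_graph R_class_closed)

lemma preblock_root_iff:
  assumes "R1_injective M" "m \<in> carrier M"
  shows "preblock_root X R (schutz_graph X R m) B s \<longleftrightarrow> s \<in> R_class M m \<and> B = preblock_at s"
proof
  assume "preblock_root X R (schutz_graph X R m) B s"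
  then show "s \<in> R_class M m \<and> B = preblock_at s"
    using image_graph_morphism[OF assms(2)] by (auto simp: preblock_root_def simp flip: M_def)
next
  assume s: "s \<in> R_class M m \<and> B = preblock_at s"
  then show "preblock_root X R (schutz_graph X R m) B s"
    using injective_morphism_left_translation[OF assms, of s] R_class_closed[of s m]
    unfolding preblock_root_def M_def[symmetric]
    by (intro exI[of _ "\<lambda>n. s \<otimes> n"]) (simp add: preblock_at_def)
qed

lemma preblock_iff:
  assumes "R1_injective M" "m \<in> carrier M"
  shows "preblock X R (schutz_graph X R m) B \<longleftrightarrow> (\<exists>s \<in> R_class M m. B = preblock_at s)"
proof -
  have "preblock X R (schutz_graph X R m) B \<longleftrightarrow> (\<exists>s. preblock_root X R (schutz_graph X R m) B s)"
    by (auto simp: preblock_def preblock_root_def)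
  then show ?thesis
    using preblock_root_iff[OF assms] by blast
qed

text \<open>A relator labels a loop at each vertex of a preblock, within the preblock, because it does
  so in the Schuetzenberger graph of \<open>1\<close>.\<close>

lemma reads_relator_preblock_at:
  assumes sp: "special_presentation X R" and r: "(r, []) \<in> R" and v: "v \<in> verts (preblock_at s)"
  shows "reads (preblock_at s) v r v"
proof -
  obtain n where n: "n \<in> R_class M \<one>" "v = s \<otimes> n" using v by (auto simp: verts_preblock_at)
  have "r \<in> words X" using relations r by auto
  moreover have "val X R r = \<one>" using val_eq_if_relation[OF r] by (simp add: val_Nil)
  ultimately have "reads (schutz_graph X R \<one>) n r n"
    using n by (simp add: reads_schutz_graph_iff R_class_closed)
  then show ?thesis
    unfolding n(2) by (rule reads_map) (auto simp: verts_preblock_at verts_schutz_graph arcs_preblock_at)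
qed

end

section \<open>The blocks of a Schuetzenberger graph\<close>

locale schutz_graph_of_word = presentation +
  fixes w
  assumes special: "special_presentation X R"
    and R1_injective: "R1_injective M"
    and w: "w \<in> words X"
begin

abbreviation m where "m \<equiv> val X R w"
abbreviation \<Gamma> where "\<Gamma> \<equiv> schutz_graph X R m"
abbreviation root where "root \<equiv> val X R (w @ inv_word w)"

lemma val_w_closed: "m \<in> carrier M"
  using w by simp

sublocale \<Gamma>: bideterministic_graph \<Gamma>
  by (rule bideterministic_schutz_graph[OF val_w_closed])

lemma root_eq: "root = m \<otimes> sinv M m"
  using w by (simp add: val_append sinv_val)

lemma root_schutz_root: "schutz_root X R m = root"
  by (simp add: schutz_root_def root_eq flip: M_def)

lemma root_idem: "root \<otimes> root = root"
  using idem_mult_sinv[OF val_w_closed] by (simp add: root_eq)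

lemma root_in_R_class: "root \<in> R_class M m"
  using w root_idem by (simp add: R_class_iff sinv_idem) (simp add: root_eq)

lemma root_mult: "s \<in> R_class M m \<Longrightarrow> root \<otimes> s = s"
  using mult_sinv_mult[of s] by (simp add: R_class_iff[OF val_w_closed] root_eq)

lemma reads_from_root_iff:
  "u \<in> words X \<Longrightarrow> reads \<Gamma> root u t \<longleftrightarrow> t = root \<otimes> val X R u \<and> t \<in> R_class M m"
  using reads_schutz_graph_iff[OF val_w_closed _ root_in_R_class] .

lemma vertex_reached_from_root:
  assumes "s \<in> R_class M m"
  obtains u where "u \<in> words X" "reads \<Gamma> root u s"
proof -
  obtain u where "u \<in> words X" "s = val X R u"
    using R_class_closed[OF assms] by (auto simp: carrier_M)
  then have "reads \<Gamma> root u s"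
    using assms root_mult by (simp add: reads_from_root_iff)
  then show thesis using that \<open>u \<in> words X\<close> by blast
qed

lemma reads_w: "reads \<Gamma> root w m"
  using reads_from_root_iff[OF w] root_mult[of m] w by simp

lemma connected_\<Gamma>: "Digraph_Component.connected \<Gamma>"
proof -
  have "\<exists>u. reads \<Gamma> a u b" if ab: "a \<in> R_class M m" "b \<in> R_class M m" for a b
  proof -
    obtain u v where "reads \<Gamma> root u a" "reads \<Gamma> root v b"
      using vertex_reached_from_root ab by metis
    then show ?thesis
      using \<Gamma>.reads_append \<Gamma>.reads_inv_word by blast
  qed
  moreover have "wf_labelled_graph (lgraph (verts \<Gamma>) (arcs \<Gamma>))"
    using \<Gamma>.ends by unfold_locales simp
  moreover have "R_class M m \<noteq> {}" using root_in_R_class by blast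
  ultimately show ?thesis
    using connected_iff_reads[of "verts \<Gamma>" "arcs \<Gamma>"] schutz_graph_lgraph[of m]
    by (simp add: verts_schutz_graph)
qed

text \<open>A subgraph in which relators are loops and in which \<open>w\<close> is readable at the root supports the
  action of \<open>M\<close>. Every word \<open>h\<close> that is readable at the root of \<open>\<Gamma>\<close> has \<open>h h\<^sup>-\<^sup>1\<close> above \<open>w w\<^sup>-\<^sup>1\<close>
  in the order of idempotents, so \<open>h\<close> is readable in the subgraph because \<open>w w\<^sup>-\<^sup>1\<close> is.\<close>

lemma subgraph_reading_w_is_all:
  assumes \<Delta>: "wf_labelled_graph \<Delta>" and sub: "verts \<Delta> \<subseteq> verts \<Gamma>" "arcs \<Delta> \<subseteq> arcs \<Gamma>"
    and loops: "\<And>r v. (r, []) \<in> R \<Longrightarrow> v \<in> verts \<Delta> \<Longrightarrow> reads \<Delta> v r v"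
    and rw: "reads \<Delta> root w t"
  shows "verts \<Gamma> \<subseteq> verts \<Delta>" "arcs \<Gamma> \<subseteq> arcs \<Delta>"
proof -
  interpret \<Delta>: wf_labelled_graph \<Delta> by (rule \<Delta>)
  interpret \<Delta>: bideterministic_graph \<Delta>
    by unfold_locales (meson sub(2) subsetD \<Gamma>.det \<Gamma>.codet)+
  have reads: "reads \<Delta> root h s" if h: "h \<in> words X" "reads \<Gamma> root h s" for h s
  proof -
    have s: "s = root \<otimes> val X R h" "s \<in> R_class M m" using h by (auto simp: reads_from_root_iff)
    then have "root \<otimes> val X R h \<otimes> sinv M (val X R h) = root"
      using R_class_mult_iff[OF val_w_closed root_in_R_class] h(1) by simp
    then have val: "val X R ((w @ inv_word w) @ (h @ inv_word h)) = val X R (w @ inv_word w)"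
      using h(1) w val_append[of "w @ inv_word w" "h @ inv_word h"]
      by (simp add: val_append[of h] sinv_val m_assoc)
    have "reads \<Delta> root (w @ inv_word w) root"
      using rw \<Delta>.reads_append_inv_word by blast
    then have "reads \<Delta> root ((w @ inv_word w) @ (h @ inv_word h)) root"
      using \<Delta>.reads_val_cong[OF special loops _ _ val] h(1) w by simp
    then obtain s' where s': "reads \<Delta> root h s'"
      using \<Delta>.reads_append \<Delta>.reads_append_inv_word by metis
    moreover have "s' = s"
      using reads_mono[OF s' sub] h(2) \<Gamma>.reads_deterministic by blast
    ultimately show ?thesis by simp
  qed
  show "verts \<Gamma> \<subseteq> verts \<Delta>"
  proof
    fix s assume "s \<in> verts \<Gamma>"
    then obtain h where "h \<in> words X" "reads \<Gamma> root h s"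
      using vertex_reached_from_root by (auto simp: verts_schutz_graph)
    then show "s \<in> verts \<Delta>" by (rule reads_end[OF reads])
  qed
  show "arcs \<Gamma> \<subseteq> arcs \<Delta>"
  proof
    fix e assume e: "e \<in> arcs \<Gamma>"
    obtain s x t where e': "e = (s, x, t)" by (cases e)
    have "s \<in> R_class M m" "t \<in> R_class M m" and x: "x \<in> X" using e by (auto simp: e' arcs_schutz_graph)
    then obtain h where h: "h \<in> words X" "reads \<Gamma> root h s"
      using vertex_reached_from_root by blast
    have "reads \<Gamma> s [Pos x] t"
      using e \<open>t \<in> R_class M m\<close> by (simp add: e' reads_Pos verts_schutz_graph)
    then have "reads \<Gamma> root (h @ [Pos x]) t"
      using h(2) \<Gamma>.reads_append by blast
    then have "reads \<Delta> root (h @ [Pos x]) t"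
      using reads h(1) x by (simp add: words_Cons)
    then obtain s' where s': "reads \<Delta> root h s'" "reads \<Delta> s' [Pos x] t"
      unfolding \<Delta>.reads_append by blast
    have "s' = s"
      using reads[OF h] s'(1) \<Delta>.reads_deterministic by blast
    then show "e \<in> arcs \<Delta>"
      using s'(2) by (auto simp: e' reads_Pos)
  qed
qed

lemma reads_prefix:
  assumes "prefix u w"
  shows "reads \<Gamma> root u (root \<otimes> val X R u)" "root \<otimes> val X R u \<in> R_class M m"
proof -
  obtain v where v: "w = u @ v" using assms by (auto simp: prefix_def)
  then have "u \<in> words X" using w by simp
  moreover obtain t where "reads \<Gamma> root u t"
    using reads_w \<Gamma>.reads_append v by metis
  ultimately show "reads \<Gamma> root u (root \<otimes> val X R u)" "root \<otimes> val X R u \<in> R_class M m"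
    by (auto simp: reads_from_root_iff)
qed

text \<open>The path labelled \<open>w\<close> together with the preblocks rooted at its vertices satisfies the
  hypotheses of \<open>subgraph_reading_w_is_all\<close>.\<close>

lemma preblocks_at_prefixes_cover:
  assumes p: "labelled_path \<Gamma> root w p t"
  shows "s \<in> verts \<Gamma> \<Longrightarrow> \<exists>u. prefix u w \<and> s \<in> verts (preblock_at (root \<otimes> val X R u))"
    and "e \<in> arcs \<Gamma> \<Longrightarrow> e \<in> set p \<or> (\<exists>u. prefix u w \<and> e \<in> arcs (preblock_at (root \<otimes> val X R u)))"
proof -
  let ?P = "\<lambda>u. preblock_at (root \<otimes> val X R u)"
  define \<Delta> where "\<Delta> = lgraph (\<Union>u\<in>{u. prefix u w}. verts (?P u)) ((\<Union>u\<in>{u. prefix u w}. arcs (?P u)) \<union> set p)"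
  note P_sub = preblock_at_subset_schutz_graph[OF val_w_closed reads_prefix(2)]
  have prefix_vertex: "c \<in> verts \<Delta>" if "prefix u w" "labelled_path \<Gamma> root u q c" for u q c
  proof -
    have "reads \<Gamma> root u c" using that(2) by (auto simp: reads_def)
    then have "c = root \<otimes> val X R u"
      using reads_prefix(1)[OF that(1)] by (rule \<Gamma>.reads_deterministic)
    then show ?thesis
      using that(1) root_in_preblock_at[of c] R_class_closed[OF reads_prefix(2)[OF that(1)]]
      by (auto simp: \<Delta>_def)
  qed
  have sub: "verts \<Delta> \<subseteq> verts \<Gamma>" "arcs \<Delta> \<subseteq> arcs \<Gamma>"
    using P_sub labelled_path_arcs[OF p] by (auto simp: \<Delta>_def)
  have wf: "wf_labelled_graph \<Delta>"
  proof
    fix a x b assume "(a, x, b) \<in> arcs \<Delta>"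
    then consider u where "prefix u w" "(a, x, b) \<in> arcs (?P u)" | "(a, x, b) \<in> set p"
      by (auto simp: \<Delta>_def)
    then show "a \<in> verts \<Delta> \<and> b \<in> verts \<Delta>"
    proof cases
      case 1
      then have "a \<in> verts (?P u) \<and> b \<in> verts (?P u)"
        by (auto simp: arcs_preblock_at verts_preblock_at map_edge_def arcs_schutz_graph)
      then show ?thesis using 1 by (auto simp: \<Delta>_def)
    next
      case 2
      have "root \<in> verts \<Gamma>" using root_in_R_class by (simp add: verts_schutz_graph)
      then have "(\<exists>u q. prefix u w \<and> labelled_path \<Gamma> root u q a) \<and>
          (\<exists>u q. prefix u w \<and> labelled_path \<Gamma> root u q b)"
        by (rule labelled_path_edge_ends[OF p 2]) (rule \<Gamma>.ends)
      then show ?thesis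
        using prefix_vertex by blast
    qed
  qed
  have loops: "reads \<Delta> v r v" if r: "(r, []) \<in> R" and v: "v \<in> verts \<Delta>" for r v
  proof -
    obtain u where u: "prefix u w" "v \<in> verts (?P u)" using v by (auto simp: \<Delta>_def)
    have "reads (?P u) v r v"
      by (rule reads_relator_preblock_at[OF special r u(2)])
    then show ?thesis
      by (rule reads_mono) (use u(1) in \<open>auto simp: \<Delta>_def\<close>)
  qed
  have "t \<in> verts \<Delta>" using prefix_vertex[OF _ p] by simp
  then have "labelled_path \<Delta> root w p t"
    by (intro labelled_path_transfer[OF p]) (auto simp: \<Delta>_def)
  then have "reads \<Delta> root w t" by (auto simp: reads_def)
  note all = subgraph_reading_w_is_all[OF wf sub loops this]
  show "s \<in> verts \<Gamma> \<Longrightarrow> \<exists>u. prefix u w \<and> s \<in> verts (?P u)"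
    using subsetD[OF all(1)] by (auto simp: \<Delta>_def)
  show "e \<in> arcs \<Gamma> \<Longrightarrow> e \<in> set p \<or> (\<exists>u. prefix u w \<and> e \<in> arcs (?P u))"
    using subsetD[OF all(2), of e] by (auto simp: \<Delta>_def)
qed

lemma block_iff:
  "block X R \<Gamma> B \<longleftrightarrow> (\<exists>s\<in>R_class M m. B = preblock_at s \<and>
    (\<forall>t\<in>R_class M m. subgraph (preblock_at s) (preblock_at t) \<longrightarrow> preblock_at t = preblock_at s))"
  unfolding block_def pre_digraph.max_subgraph_def preblock_iff[OF R1_injective val_w_closed]
  using subgraph_preblock_at_schutz_graph[OF val_w_closed] by metis

lemma preblock_at_eqI:
  assumes "subgraph (preblock_at s) (preblock_at t)" "subgraph (preblock_at t) (preblock_at s)"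
  shows "preblock_at s = preblock_at t"
  using assms by (auto simp: subgraph_def preblock_at_def image_graph_def lgraph_def)

text \<open>Every preblock lies in one of the finitely many preblocks rooted on the path labelled \<open>w\<close>,
  so a maximal one of these is a block.\<close>

lemma preblock_in_block_at_prefix:
  assumes s: "s \<in> R_class M m"
  obtains u where "prefix u w" "block X R \<Gamma> (preblock_at (root \<otimes> val X R u))"
    "subgraph (preblock_at s) (preblock_at (root \<otimes> val X R u))"
proof -
  let ?P = "\<lambda>u. preblock_at (root \<otimes> val X R u)"
  obtain p t where p: "labelled_path \<Gamma> root w p t" using reads_w by (auto simp: reads_def)
  have cover: "\<exists>u. prefix u w \<and> subgraph (preblock_at s) (?P u)" if "s \<in> R_class M m" for s
    using preblocks_at_prefixes_cover(1)[OF p, of s] that subgraph_preblock_at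
      R_class_closed[OF reads_prefix(2)]
    by (metis verts_schutz_graph)
  (* A preblock is determined by its vertices, since its inclusion in another one amounts to its
     root being a vertex of the other one. So it is enough to maximise the set of vertices. *)
  let ?A = "(\<lambda>u. verts (?P u)) ` {u. prefix u w}"
  have "finite {u. prefix u w}"
    using finite_set[of "prefixes w"] by (simp add: set_prefixes_eq)
  then have fin: "finite ?A" by simp
  obtain u0 where u0: "prefix u0 w" "subgraph (preblock_at s) (?P u0)" using cover[OF s] by blast
  then have "verts (?P u0) \<in> ?A" by blast
  from finite_has_maximal2[OF fin this]
  obtain V where V: "V \<in> ?A" "verts (?P u0) \<subseteq> V" "\<And>V'. V' \<in> ?A \<Longrightarrow> V \<subseteq> V' \<Longrightarrow> V = V'"
    by metis
  from V(1) obtain u where "prefix u w" "V = verts (?P u)" by auto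
  with V(2) have u: "prefix u w" "verts (?P u0) \<subseteq> verts (?P u)" by simp_all
  have max: "verts (?P v) = verts (?P u)" if "prefix v w" "verts (?P u) \<subseteq> verts (?P v)" for v
    using V(3)[of "verts (?P v)"] that \<open>V = verts (?P u)\<close> by auto
  have carr: "root \<otimes> val X R v \<in> carrier M" if "prefix v w" for v
    using R_class_closed[OF reads_prefix(2)[OF that]] .
  have by_verts: "subgraph (preblock_at a) (?P v)"
    if "prefix v w" "a \<in> carrier M" "verts (preblock_at a) \<subseteq> verts (?P v)" for a v
    using that root_in_preblock_at[of a] by (intro subgraph_preblock_at carr) auto
  have "block X R \<Gamma> (?P u)"
    unfolding block_iff
  proof (intro bexI[of _ "root \<otimes> val X R u"] conjI ballI impI refl)
    show "root \<otimes> val X R u \<in> R_class M m" using reads_prefix(2)[OF u(1)] .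
    fix t assume t: "t \<in> R_class M m" "subgraph (?P u) (preblock_at t)"
    obtain v where v: "prefix v w" "subgraph (preblock_at t) (?P v)" using cover[OF t(1)] by blast
    have "verts (?P v) = verts (?P u)"
      using max[OF v(1)] t(2) v(2) by (auto simp: subgraph_def)
    then have "subgraph (preblock_at t) (?P u)"
      using v(2) R_class_closed[OF t(1)] by (intro by_verts[OF u(1)]) (auto simp: subgraph_def)
    then show "preblock_at t = ?P u" using t(2) by (rule preblock_at_eqI)
  qed
  moreover have "subgraph (preblock_at s) (?P u)"
    using by_verts[OF u(1), of s] u0(2) u(2) R_class_closed[OF s] by (auto simp: subgraph_def)
  ultimately show thesis using that u(1) by blast
qed

lemma block_at_prefix:
  assumes "block X R \<Gamma> B"
  obtains u where "prefix u w" "B = preblock_at (root \<otimes> val X R u)"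
proof -
  obtain s where s: "s \<in> R_class M m" "B = preblock_at s"
    and max: "\<And>t. t \<in> R_class M m \<Longrightarrow> subgraph (preblock_at s) (preblock_at t) \<Longrightarrow> preblock_at t = preblock_at s"
    using assms unfolding block_iff by blast
  obtain u where u: "prefix u w" "subgraph (preblock_at s) (preblock_at (root \<otimes> val X R u))"
    using preblock_in_block_at_prefix[OF s(1)] by blast
  then show thesis
    using that[OF u(1)] max[OF reads_prefix(2)[OF u(1)] u(2)] s(2) by simp
qed

lemma edge_in_block_iff:
  "(\<exists>B. block X R \<Gamma> B \<and> e \<in> arcs B) \<longleftrightarrow> (\<exists>s\<in>R_class M m. e \<in> arcs (preblock_at s))"
proof
  assume "\<exists>B. block X R \<Gamma> B \<and> e \<in> arcs B"
  then show "\<exists>s\<in>R_class M m. e \<in> arcs (preblock_at s)" unfolding block_iff by blast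
next
  assume "\<exists>s\<in>R_class M m. e \<in> arcs (preblock_at s)"
  then show "\<exists>B. block X R \<Gamma> B \<and> e \<in> arcs B"
    by (meson preblock_in_block_at_prefix subgraph_def subset_iff)
qed

text \<open>In the double cover twisted along \<open>e\<close>, the relators label loops because their loops in
  \<open>\<Gamma>\<close> stay in preblocks, and a path that returns to the root through \<open>e\<close> would end on the wrong
  sheet.\<close>

lemma cut_edge_if_not_in_preblock:
  assumes e: "e \<in> arcs \<Gamma>" and not_in: "\<And>s. s \<in> R_class M m \<Longrightarrow> e \<notin> arcs (preblock_at s)"
  shows "cut_edge \<Gamma> e"
proof (rule ccontr)
  let ?H = "lgraph (verts \<Gamma>) (arcs \<Gamma> - {e})"
  let ?C = "double_cover \<Gamma> e"
  have del: "pre_digraph.del_arc \<Gamma> e = ?H"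
    by (simp add: pre_digraph.del_arc_def schutz_graph_def Let_def lgraph_def)
  assume "\<not> cut_edge \<Gamma> e"
  then have conn: "Digraph_Component.connected ?H"
    using connected_\<Gamma> e by (simp add: cut_edge_def del)
  interpret H: wf_labelled_graph ?H
    using \<Gamma>.ends by unfold_locales auto
  interpret C: bideterministic_graph ?C by (rule \<Gamma>.bideterministic_double_cover)
  have lift: "reads ?C (a, i) u (b, i)" if ab: "reads ?H a u b" for a b u i
  proof -
    obtain p where p: "labelled_path ?H a u p b" using ab by (auto simp: reads_def)
    then have sub: "set p \<subseteq> arcs \<Gamma> - {e}" using labelled_path_arcs by fastforce
    then have "labelled_path \<Gamma> a u p b"
      using labelled_path_end[OF p] by (intro labelled_path_transfer[OF p]) auto
    then show ?thesis using sub by (intro labelled_path_avoiding_lifts) auto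
  qed
  have loops: "reads ?C v r v" if r: "(r, []) \<in> R" and vC: "v \<in> verts ?C" for r v
  proof -
    obtain s i where v: "v = (s, i)" "s \<in> R_class M m"
      using vC by (auto simp: verts_double_cover verts_schutz_graph)
    have "reads (preblock_at s) s r s"
      by (rule reads_relator_preblock_at[OF special r root_in_preblock_at[OF R_class_closed[OF v(2)]]])
    then have "reads ?H s r s"
      by (rule reads_mono)
        (use preblock_at_subset_schutz_graph[OF val_w_closed v(2)] not_in[OF v(2)] in auto)
    then show ?thesis unfolding v(1) by (rule lift)
  qed
  obtain s x t where e': "e = (s, x, t)" by (cases e)
  then have st: "s \<in> verts \<Gamma>" "t \<in> verts \<Gamma>" "root \<in> verts \<Gamma>" and x: "x \<in> X"
    using e root_in_R_class by (auto simp: arcs_schutz_graph verts_schutz_graph)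
  then obtain h k where hk: "reads ?H root h s" "reads ?H t k root"
    using conn unfolding connected_iff_reads[OF H.wf_labelled_graph_axioms] by blast
  (* h and k avoid e, so z labels a closed path at the root that traverses e exactly once. *)
  let ?z = "h @ [Pos x] @ k"
  have "reads \<Gamma> root h s" "reads \<Gamma> t k root" using hk reads_mono by fastforce+
  have "reads \<Gamma> s [Pos x] t" using e st by (simp add: e' reads_Pos)
  have z: "reads \<Gamma> root ?z root"
    using \<open>reads \<Gamma> root h s\<close> \<open>reads \<Gamma> t k root\<close> \<open>reads \<Gamma> s [Pos x] t\<close>
    unfolding \<Gamma>.reads_append by blast
  have zX: "?z \<in> words X"
    by (rule reads_schutz_graph_words[OF z])
  have "root \<otimes> val X R ?z = root"
    using z zX reads_from_root_iff by metis
  then have val: "val X R ((w @ inv_word w) @ ?z) = val X R (w @ inv_word w)"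
    using val_append[of "w @ inv_word w" ?z] w zX by simp
  have "reads ?C (s, False) [Pos x] (t, True)"
    using e st by (auto simp: reads_Pos arcs_double_cover e' verts_double_cover)
  then have zC: "reads ?C (root, False) ?z (root, True)"
    using lift[OF hk(1)] lift[OF hk(2)] unfolding C.reads_append by blast
  have wC: "reads ?C (root, False) (w @ inv_word w) (root, False)"
    using reads_lifts[OF reads_w] C.reads_append_inv_word by blast
  then have "reads ?C (root, False) ((w @ inv_word w) @ ?z) (root, True)"
    using zC C.reads_append by blast
  then have "reads ?C (root, False) (w @ inv_word w) (root, True)"
    using C.reads_val_cong[OF special loops _ _ val] w zX by simp
  then show False
    using wC C.reads_deterministic by blast
qed

end

theorem lemma4p6:
  fixes X :: "'x set" and R :: "'x letter list rel" and w :: "'x letter list"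
  assumes "special_presentation X R"
    and "R1_injective (presented_monoid X R)"
    and "w \<in> words X"
  shows "let \<Gamma> = schutz_graph X R (val X R w);
             root = schutz_root X R (val X R w) in
     finite {B. block X R \<Gamma> B} \<and>
     (\<forall>P. preblock X R \<Gamma> P \<longrightarrow> (\<exists>B. block X R \<Gamma> B \<and> subgraph P B)) \<and>
     (\<forall>v \<in> verts \<Gamma>. \<exists>B. block X R \<Gamma> B \<and> v \<in> verts B) \<and>
     finite {e \<in> arcs \<Gamma>. \<not> (\<exists>B. block X R \<Gamma> B \<and> e \<in> arcs B)} \<and>
     (\<forall>e \<in> arcs \<Gamma>. \<not> (\<exists>B. block X R \<Gamma> B \<and> e \<in> arcs B) \<longrightarrow>
        cut_edge \<Gamma> e \<and> (\<exists>p v. labelled_path \<Gamma> root w p v \<and> e \<in> set p)) \<and>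
     (\<forall>B. block X R \<Gamma> B \<longrightarrow>
        (\<exists>r u p. preblock_root X R \<Gamma> B r \<and> prefix u w \<and> labelled_path \<Gamma> root u p r))"
proof -
  interpret schutz_graph_of_word X R "presented_monoid X R" w
    using assms by unfold_locales (auto simp: special_presentation_def)
  obtain p t where p: "labelled_path \<Gamma> root w p t" using reads_w by (auto simp: reads_def)
  have on_path: "e \<in> set p" if "e \<in> arcs \<Gamma>" "\<not> (\<exists>B. block X R \<Gamma> B \<and> e \<in> arcs B)" for e
    using preblocks_at_prefixes_cover(2)[OF p that(1)] that(2) reads_prefix(2)
    unfolding edge_in_block_iff by blast
  show ?thesis
    unfolding Let_def root_schutz_root
  proof (intro conjI allI ballI impI)
    have "finite {u. prefix u w}"
      using finite_set[of "prefixes w"] by (simp add: set_prefixes_eq)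
    moreover have "{B. block X R \<Gamma> B} \<subseteq> (\<lambda>u. preblock_at (root \<otimes>\<^bsub>presented_monoid X R\<^esub> val X R u)) ` {u. prefix u w}"
      using block_at_prefix by blast
    ultimately show "finite {B. block X R \<Gamma> B}"
      using finite_surj by blast
    show "\<exists>B. block X R \<Gamma> B \<and> subgraph P B" if "preblock X R \<Gamma> P" for P
      using that preblock_in_block_at_prefix unfolding preblock_iff[OF R1_injective val_w_closed] by metis
    show "\<exists>B. block X R \<Gamma> B \<and> v \<in> verts B" if v: "v \<in> verts \<Gamma>" for v
    proof -
      have R: "v \<in> R_class (presented_monoid X R) m" using v by (simp add: verts_schutz_graph)
      then have "v \<in> verts (preblock_at v)" using root_in_preblock_at R_class_closed by blast
      then show ?thesis
        using preblock_in_block_at_prefix[OF R] unfolding subgraph_def by blast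
    qed
    show "finite {e \<in> arcs \<Gamma>. \<not> (\<exists>B. block X R \<Gamma> B \<and> e \<in> arcs B)}"
      by (rule finite_subset[of _ "set p"]) (use on_path in auto)
    show "cut_edge \<Gamma> e" if "e \<in> arcs \<Gamma>" "\<not> (\<exists>B. block X R \<Gamma> B \<and> e \<in> arcs B)" for e
      using that cut_edge_if_not_in_preblock unfolding edge_in_block_iff by blast
    show "\<exists>p v. labelled_path \<Gamma> root w p v \<and> e \<in> set p"
      if "e \<in> arcs \<Gamma>" "\<not> (\<exists>B. block X R \<Gamma> B \<and> e \<in> arcs B)" for e
      using on_path[OF that] p by blast
    show "\<exists>r u p. preblock_root X R \<Gamma> B r \<and> prefix u w \<and> labelled_path \<Gamma> root u p r"
      if "block X R \<Gamma> B" for B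
    proof -
      obtain u where u: "prefix u w" "B = preblock_at (root \<otimes>\<^bsub>presented_monoid X R\<^esub> val X R u)"
        using block_at_prefix[OF \<open>block X R \<Gamma> B\<close>] by blast
      then show ?thesis
        using reads_prefix[OF u(1)] preblock_root_iff[OF R1_injective val_w_closed]
        unfolding reads_def by blast
    qed
  qed
qed

end
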